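(* Let $\mathbb{F}_q$ be a finite field of characteristic different from $2$, let $f(x)\in\mathbb{F}_q[x]$ be an irreducible polynomial of degree $d$, and let $N: y^2=xf(x)^2$ be the corresponding nodal curve over $\mathbb{F}_q$. Let $h_1(x),h_2(x)\in\mathbb{F}_q[x]$ satisfy $\gcd(f(x),x-h_i(x)^2)=1$ and $\deg(h_i(x))<d$ for each $i=1,2$. Let $D_1=[f(x)^2,h_1(x)f(x)]$ and $D_2=[f(x)^2,h_2(x)f(x)]$ be the two corresponding divisor classes in $\mathrm{Jac}(N)$. Then one finds $$D_1+D_2=D_3=[f(x)^2,\,h_3(x)f(x)]$$ via the following two steps: (1) finding two polynomials $g_1(x),g_2(x)\in\mathbb{F}_q[x]$ such that $$g_1(x)f(x)+g_2(x)\bigl(h_1(x)+h_2(x)\bigr)=1;$$ (2) then computing $$h_3(x)\equiv f(x)h_1(x)g_1(x)+g_2(x)\bigl(h_1(x)h_2(x)+x\bigr)\pmod{f(x)}$$ with $\deg(h_3(x))<d$.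
   Context: A nodal curve here means a curve $N: y^2=xf(x)^2$ over $\mathbb{F}_q$ (characteristic $\neq 2$) with $f(x)\in\mathbb{F}_q[x]$ irreducible. Its (generalized) Jacobian $\mathrm{Jac}(N)$ is the ideal class group of the coordinate ring $A=\mathbb{F}_q[x,y]/(y^2-xf(x)^2)$, i.e. the group of invertible fractional ideals of $A$ modulo principal ones, written additively. Mumford representation: a pair of polynomials $[u(x),v(x)]$ in $\mathbb{F}_q[x]$ represents an element of $\mathrm{Jac}(N)$ if (1) $\deg v<\deg u$; (2) $u(x)$ divides $v(x)^2-xf(x)^2$; (3) whenever $(a,0)$ is a singular point of $N$ (i.e. $a$ in the algebraic closure of $\mathbb{F}_q$ is a multiple root of $xf(x)^2$) and $x-a$ divides both $u(x)$ and $v(x)$, then $x-a$ does not divide $\dfrac{xf(x)^2-v(x)^2}{u(x)}$. The element represented by $[u(x),v(x)]$ is the class of the ideal of $A$ generated by $u(x)$ and $y-v(x)$, and is also denoted $[u(x),v(x)]$. The identity element is represented by $[1,0]$. The zero polynomial is regarded as having degree less than any non-negative integer.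
   Formalization: The existence of g_1, g_2 in step (1) is asserted only when h_1 + h_2 ≠ 0; if h_1 + h_2 = 0 the equation becomes g_1 f = 1, which is impossible for irreducible f (e.g. h_1 = h_2 = 0 with f coprime to x). *)

theory Defs
  imports
    "HOL-Algebra.Algebraic_Closure_Type"
    "HOL-Algebra.QuotRing"
    "HOL-Algebra.Ideal_Product"
    "HOL-Number_Theory.Cong"
begin

section \<open>The ideal class group of an integral domain\<close>

text \<open>HOL-Algebra has no field of fractions of a domain given by a carrier, so we construct it
  as the set of classes of pairs (numerator, denominator).\<close>

definition frac_rel :: "('a, 'm) ring_scheme \<Rightarrow> (('a \<times> 'a) \<times> ('a \<times> 'a)) set" where
  "frac_rel R = {((a, b), (c, d)).
     a \<in> carrier R \<and> b \<in> carrier R - {\<zero>\<^bsub>R\<^esub>} \<and> c \<in> carrier R \<and> d \<in> carrier R - {\<zero>\<^bsub>R\<^esub>} \<and>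
     a \<otimes>\<^bsub>R\<^esub> d = c \<otimes>\<^bsub>R\<^esub> b}"

definition frac_class :: "('a, 'm) ring_scheme \<Rightarrow> 'a \<Rightarrow> 'a \<Rightarrow> ('a \<times> 'a) set" where
  "frac_class R a b = frac_rel R `` {(a, b)}"

text \<open>In the operations below all members of the unions coincide, as for quotients in
  \<^theory>\<open>HOL.Equiv_Relations\<close>.\<close>

definition frac_field :: "('a, 'm) ring_scheme \<Rightarrow> ('a \<times> 'a) set ring" where
  "frac_field R =
     \<lparr>carrier = (carrier R \<times> (carrier R - {\<zero>\<^bsub>R\<^esub>})) // frac_rel R,
      monoid.mult = (\<lambda>p q. \<Union>(a, b)\<in>p. \<Union>(c, d)\<in>q. frac_class R (a \<otimes>\<^bsub>R\<^esub> c) (b \<otimes>\<^bsub>R\<^esub> d)),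
      one = frac_class R \<one>\<^bsub>R\<^esub> \<one>\<^bsub>R\<^esub>,
      ring.zero = frac_class R \<zero>\<^bsub>R\<^esub> \<one>\<^bsub>R\<^esub>,
      add = (\<lambda>p q. \<Union>(a, b)\<in>p. \<Union>(c, d)\<in>q.
               frac_class R ((a \<otimes>\<^bsub>R\<^esub> d) \<oplus>\<^bsub>R\<^esub> (c \<otimes>\<^bsub>R\<^esub> b)) (b \<otimes>\<^bsub>R\<^esub> d))\<rparr>"

definition frac_embed :: "('a, 'm) ring_scheme \<Rightarrow> 'a \<Rightarrow> ('a \<times> 'a) set" where
  "frac_embed R r = frac_class R r \<one>\<^bsub>R\<^esub>"

definition fractional_ideal :: "('a, 'm) ring_scheme \<Rightarrow> ('a \<times> 'a) set set \<Rightarrow> bool" where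
  "fractional_ideal R I \<longleftrightarrow>
     subgroup I (add_monoid (frac_field R)) \<and>
     (\<forall>r\<in>carrier R. \<forall>z\<in>I. frac_embed R r \<otimes>\<^bsub>frac_field R\<^esub> z \<in> I) \<and>
     (\<exists>d\<in>carrier R - {\<zero>\<^bsub>R\<^esub>}. \<forall>z\<in>I.
        frac_embed R d \<otimes>\<^bsub>frac_field R\<^esub> z \<in> frac_embed R ` carrier R)"

text \<open>The set \<^const>\<open>ideal_prod\<close> consists of the finite sums of products; it is taken in the field
  of fractions, where it is the usual product of fractional ideals.\<close>

definition invertible_frac_ideals :: "('a, 'm) ring_scheme \<Rightarrow> ('a \<times> 'a) set set monoid" where
  "invertible_frac_ideals R =
     \<lparr>carrier = {I. fractional_ideal R I \<and>
                    (\<exists>J. fractional_ideal R J \<and>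
                         ideal_prod (frac_field R) I J = frac_embed R ` carrier R)},
      monoid.mult = ideal_prod (frac_field R),
      one = frac_embed R ` carrier R\<rparr>"

definition principal_frac_ideals :: "('a, 'm) ring_scheme \<Rightarrow> ('a \<times> 'a) set set set" where
  "principal_frac_ideals R =
     {z <#\<^bsub>frac_field R\<^esub> (frac_embed R ` carrier R) | z.
        z \<in> carrier (frac_field R) - {\<zero>\<^bsub>frac_field R\<^esub>}}"

definition ideal_class_group :: "('a, 'm) ring_scheme \<Rightarrow> ('a \<times> 'a) set set set monoid" where
  "ideal_class_group R = invertible_frac_ideals R Mod principal_frac_ideals R"

definition ideal_class :: "('a, 'm) ring_scheme \<Rightarrow> 'a set \<Rightarrow> ('a \<times> 'a) set set set" where
  "ideal_class R I = principal_frac_ideals R #>\<^bsub>invertible_frac_ideals R\<^esub> (frac_embed R ` I)"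


section \<open>The curve \<open>y\<^sup>2 = x f(x)\<^sup>2\<close>\<close>

text \<open>\<open>k[x,y]\<close> is rendered as \<open>k[x][y]\<close>: in \<^typ>\<open>'a poly poly\<close> the outer variable \<open>[:0, 1:]\<close> is \<open>y\<close>,
  and \<open>p \<in> k[x]\<close> is the constant \<open>[:p:]\<close>.\<close>

definition nodal_ideal :: "'a::field poly \<Rightarrow> 'a poly poly set" where
  "nodal_ideal f = genideal ring_of_type_algebra {[:0, 1:]\<^sup>2 - [:[:0, 1:] * f\<^sup>2:]}"

definition coord_ring :: "'a::field poly \<Rightarrow> 'a poly poly set ring" where
  "coord_ring f = ring_of_type_algebra Quot nodal_ideal f"

definition coord_of :: "'a::field poly \<Rightarrow> 'a poly poly \<Rightarrow> 'a poly poly set" where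
  "coord_of f p = nodal_ideal f +>\<^bsub>ring_of_type_algebra\<^esub> p"

text \<open>The group law of the Jacobian, written additively on paper, is \<open>\<otimes>\<close> of this monoid record.\<close>

definition Jac :: "'a::field poly \<Rightarrow> ('a poly poly set \<times> 'a poly poly set) set set set monoid" where
  "Jac f = ideal_class_group (coord_ring f)"

text \<open>Since \<open>degree 0 = 0\<close>, the convention that the zero polynomial has degree less than any
  non-negative integer has to be spelled out in the first condition.\<close>

definition mumford_rep :: "'a::field poly \<Rightarrow> 'a poly \<Rightarrow> 'a poly \<Rightarrow> bool" where
  "mumford_rep f u v \<longleftrightarrow>
     u \<noteq> 0 \<and> (v = 0 \<or> degree v < degree u) \<and>
     u dvd v\<^sup>2 - [:0, 1:] * f\<^sup>2 \<and>
     (\<forall>a :: 'a alg_closure.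
        [:-a, 1:]\<^sup>2 dvd map_poly to_ac ([:0, 1:] * f\<^sup>2) \<and>
        [:-a, 1:] dvd map_poly to_ac u \<and> [:-a, 1:] dvd map_poly to_ac v \<longrightarrow>
        \<not> [:-a, 1:] dvd map_poly to_ac (([:0, 1:] * f\<^sup>2 - v\<^sup>2) div u))"

definition mumford_class ::
  "'a::field poly \<Rightarrow> 'a poly \<Rightarrow> 'a poly \<Rightarrow> ('a poly poly set \<times> 'a poly poly set) set set set" where
  "mumford_class f u v =
     ideal_class (coord_ring f)
       (genideal (coord_ring f) {coord_of f [:u:], coord_of f ([:0, 1:] - [:v:])})"

end

theory Submission
  imports Defs
begin

text \<open>Put \<open>s = y/f\<close>, so \<open>s\<^sup>2 = x\<close>, the normalisation of \<open>A\<close> is \<open>O = k[s]\<close> and \<open>A = k[x] + f O\<close>. The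
  ideal \<open>I\<^sub>h = (f\<^sup>2, y - h f)\<close> equals \<open>f (f O + (s - h) A)\<close>, and it is invertible because
  \<open>h\<^sup>2 - x\<close>, the norm of \<open>s - h\<close>, is a unit modulo \<open>f\<close>: indeed \<open>I\<^sub>h I\<^bsub>-h\<^esub> = (f\<^sup>2)\<close>. It depends on \<open>s - h\<close>
  only modulo \<open>f O\<close> and up to units of \<open>k[x]/f\<close>. Since
  \<open>(s - h\<^sub>1) (s - h\<^sub>2) = -((h\<^sub>1 + h\<^sub>2) s - (h\<^sub>1 h\<^sub>2 + x))\<close> and \<open>g\<^sub>2\<close> inverts \<open>h\<^sub>1 + h\<^sub>2\<close> modulo \<open>f\<close>, this gives
  \<open>I\<^bsub>h1\<^esub> I\<^bsub>h2\<^esub> = f I\<^bsub>h3\<^esub>\<close>. Both identities are checked on generators in \<open>A\<close>.\<close>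

section \<open>The field of fractions\<close>

context domain
begin

lemma frac_rel_iff:
  "((a, b), (c, d)) \<in> frac_rel R \<longleftrightarrow>
     a \<in> carrier R \<and> b \<in> carrier R - {\<zero>} \<and> c \<in> carrier R \<and> d \<in> carrier R - {\<zero>} \<and> a \<otimes> d = c \<otimes> b"
  by (simp add: frac_rel_def)

lemma equiv_frac_rel: "equiv (carrier R \<times> (carrier R - {\<zero>})) (frac_rel R)"
proof (rule equivI)
  show "frac_rel R \<subseteq> (carrier R \<times> (carrier R - {\<zero>})) \<times> (carrier R \<times> (carrier R - {\<zero>}))"
    by (auto simp: frac_rel_def)
  show "refl_on (carrier R \<times> (carrier R - {\<zero>})) (frac_rel R)"
    by (auto simp: refl_on_def frac_rel_def)
  show "sym (frac_rel R)"
    by (auto simp: sym_def frac_rel_def)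
  show "trans (frac_rel R)"
  proof (rule transI, clarify)
    fix a b c d e g
    assume 1: "((a, b), (c, d)) \<in> frac_rel R" and 2: "((c, d), (e, g)) \<in> frac_rel R"
    have c: "a \<in> carrier R" "b \<in> carrier R" "c \<in> carrier R" "d \<in> carrier R" "e \<in> carrier R"
      "g \<in> carrier R" "d \<noteq> \<zero>" and eq: "a \<otimes> d = c \<otimes> b" "c \<otimes> g = e \<otimes> d"
      using 1 2 by (auto simp: frac_rel_iff)
    \<comment> \<open>The outer pairs are compared after multiplication by the middle denominator
      \<open>d\<close>, which is nonzero and so cancels in a domain.\<close>
    have "d \<otimes> (a \<otimes> g) = (a \<otimes> d) \<otimes> g"
      using c by (simp add: m_ac)
    also have "\<dots> = (c \<otimes> g) \<otimes> b"
      using c unfolding eq(1) by (simp add: m_ac)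
    also have "\<dots> = d \<otimes> (e \<otimes> b)"
      using c unfolding eq(2) by (simp add: m_ac)
    finally have "a \<otimes> g = e \<otimes> b"
      using c m_lcancel[of d "a \<otimes> g" "e \<otimes> b"] by simp
    then show "((a, b), (e, g)) \<in> frac_rel R"
      using 1 2 by (simp add: frac_rel_iff)
  qed
qed

lemma frac_class_eq_iff:
  assumes "a \<in> carrier R" "b \<in> carrier R - {\<zero>}" "c \<in> carrier R" "d \<in> carrier R - {\<zero>}"
  shows "frac_class R a b = frac_class R c d \<longleftrightarrow> a \<otimes> d = c \<otimes> b"
  using eq_equiv_class_iff[OF equiv_frac_rel, of "(a, b)" "(c, d)"] assms
  by (simp add: frac_class_def frac_rel_iff)

lemma carrier_frac_field:
  "carrier (frac_field R) = {frac_class R a b | a b. a \<in> carrier R \<and> b \<in> carrier R - {\<zero>}}"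
  by (auto simp: frac_field_def quotient_def frac_class_def)

lemma frac_class_closed:
  "\<lbrakk>a \<in> carrier R; b \<in> carrier R - {\<zero>}\<rbrakk> \<Longrightarrow> frac_class R a b \<in> carrier (frac_field R)"
  by (auto simp: carrier_frac_field)

lemma frac_fieldE:
  assumes "z \<in> carrier (frac_field R)"
  obtains a b where "a \<in> carrier R" "b \<in> carrier R" "b \<noteq> \<zero>" "z = frac_class R a b"
  using assms by (auto simp: carrier_frac_field)

text \<open>The union defining the product collapses to a single class because the operation
  respects \<open>frac_rel\<close>; by commutativity it is enough to vary one argument.\<close>

lemma mult_frac_class:
  assumes "a \<in> carrier R" "b \<in> carrier R - {\<zero>}" "c \<in> carrier R" "d \<in> carrier R - {\<zero>}"
  shows "frac_class R a b \<otimes>\<^bsub>frac_field R\<^esub> frac_class R c d = frac_class R (a \<otimes> c) (b \<otimes> d)"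
proof -
  have "congruent2 (frac_rel R) (frac_rel R) (\<lambda>p q. frac_class R (fst p \<otimes> fst q) (snd p \<otimes> snd q))"
  proof (rule congruent2_commuteI[OF equiv_frac_rel])
    fix p q assume "p \<in> carrier R \<times> (carrier R - {\<zero>})" "q \<in> carrier R \<times> (carrier R - {\<zero>})"
    then show "frac_class R (fst p \<otimes> fst q) (snd p \<otimes> snd q) =
        frac_class R (fst q \<otimes> fst p) (snd q \<otimes> snd p)"
      by (simp add: m_comm mem_Times_iff)
  next
    fix p q w
    assume "w \<in> carrier R \<times> (carrier R - {\<zero>})" "(p, q) \<in> frac_rel R"
    then obtain a b c d a' b' where [simp]: "w = (a, b)" "p = (c, d)" "q = (a', b')"
      and c: "a \<in> carrier R" "b \<in> carrier R" "c \<in> carrier R" "d \<in> carrier R"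
      "a' \<in> carrier R" "b' \<in> carrier R" "b \<noteq> \<zero>" "d \<noteq> \<zero>" "b' \<noteq> \<zero>" and eq: "c \<otimes> b' = a' \<otimes> d"
      by (cases w; cases p; cases q) (auto simp: frac_rel_iff)
    have "(a \<otimes> c) \<otimes> (b \<otimes> b') = (a \<otimes> b) \<otimes> (c \<otimes> b')"
      using c by (simp add: m_ac)
    also have "\<dots> = (a \<otimes> a') \<otimes> (b \<otimes> d)"
      unfolding eq using c by (simp add: m_ac)
    finally show "frac_class R (fst w \<otimes> fst p) (snd w \<otimes> snd p) =
        frac_class R (fst w \<otimes> fst q) (snd w \<otimes> snd q)"
      using c by (simp add: frac_class_eq_iff integral_iff)
  qed
  from UN_equiv_class2[OF equiv_frac_rel equiv_frac_rel this, of "(a, b)" "(c, d)"] assms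
  show ?thesis
    by (simp add: frac_field_def frac_class_def[of _ a b] frac_class_def[of _ c d]
        case_prod_unfold)
qed

lemma add_frac_class:
  assumes "a \<in> carrier R" "b \<in> carrier R - {\<zero>}" "c \<in> carrier R" "d \<in> carrier R - {\<zero>}"
  shows "frac_class R a b \<oplus>\<^bsub>frac_field R\<^esub> frac_class R c d =
    frac_class R ((a \<otimes> d) \<oplus> (c \<otimes> b)) (b \<otimes> d)"
proof -
  have "congruent2 (frac_rel R) (frac_rel R)
     (\<lambda>p q. frac_class R ((fst p \<otimes> snd q) \<oplus> (fst q \<otimes> snd p)) (snd p \<otimes> snd q))"
  proof (rule congruent2_commuteI[OF equiv_frac_rel])
    fix p q assume "p \<in> carrier R \<times> (carrier R - {\<zero>})" "q \<in> carrier R \<times> (carrier R - {\<zero>})"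
    then show "frac_class R ((fst p \<otimes> snd q) \<oplus> (fst q \<otimes> snd p)) (snd p \<otimes> snd q) =
        frac_class R ((fst q \<otimes> snd p) \<oplus> (fst p \<otimes> snd q)) (snd q \<otimes> snd p)"
      by (simp add: m_comm a_comm mem_Times_iff)
  next
    fix p q w
    assume "w \<in> carrier R \<times> (carrier R - {\<zero>})" "(p, q) \<in> frac_rel R"
    then obtain a b c d a' b' where [simp]: "w = (a, b)" "p = (c, d)" "q = (a', b')"
      and c: "a \<in> carrier R" "b \<in> carrier R" "c \<in> carrier R" "d \<in> carrier R"
      "a' \<in> carrier R" "b' \<in> carrier R" "b \<noteq> \<zero>" "d \<noteq> \<zero>" "b' \<noteq> \<zero>" and eq: "c \<otimes> b' = a' \<otimes> d"
      by (cases w; cases p; cases q) (auto simp: frac_rel_iff)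
    have "((a \<otimes> d) \<oplus> (c \<otimes> b)) \<otimes> (b \<otimes> b') = (a \<otimes> d \<otimes> (b \<otimes> b')) \<oplus> (b \<otimes> b \<otimes> (c \<otimes> b'))"
      using c by (simp add: m_ac l_distr r_distr)
    also have "\<dots> = ((a \<otimes> b') \<oplus> (a' \<otimes> b)) \<otimes> (b \<otimes> d)"
      unfolding eq using c by (simp add: m_ac l_distr r_distr)
    finally show "frac_class R ((fst w \<otimes> snd p) \<oplus> (fst p \<otimes> snd w)) (snd w \<otimes> snd p) =
        frac_class R ((fst w \<otimes> snd q) \<oplus> (fst q \<otimes> snd w)) (snd w \<otimes> snd q)"
      using c by (simp add: frac_class_eq_iff integral_iff)
  qed
  from UN_equiv_class2[OF equiv_frac_rel equiv_frac_rel this, of "(a, b)" "(c, d)"] assms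
  show ?thesis
    by (simp add: frac_field_def frac_class_def[of _ a b] frac_class_def[of _ c d]
        case_prod_unfold)
qed

lemma one_frac_field: "\<one>\<^bsub>frac_field R\<^esub> = frac_class R \<one> \<one>"
  and zero_frac_field: "\<zero>\<^bsub>frac_field R\<^esub> = frac_class R \<zero> \<one>"
  by (simp_all add: frac_field_def)

lemmas frac_field_simps = mult_frac_class add_frac_class one_frac_field zero_frac_field
  frac_class_closed frac_class_eq_iff integral_iff

lemma cring_frac_field: "cring (frac_field R)"
proof (rule cringI)
  show "abelian_group (frac_field R)"
  proof (rule abelian_groupI)
    fix x assume "x \<in> carrier (frac_field R)"
    then obtain a b where x: "a \<in> carrier R" "b \<in> carrier R" "b \<noteq> \<zero>" "x = frac_class R a b"
      by (rule frac_fieldE)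
    have "frac_class R (\<ominus> a) b \<oplus>\<^bsub>frac_field R\<^esub> x = \<zero>\<^bsub>frac_field R\<^esub>"
      using x by (simp add: frac_field_simps l_minus l_neg)
    then show "\<exists>y\<in>carrier (frac_field R). y \<oplus>\<^bsub>frac_field R\<^esub> x = \<zero>\<^bsub>frac_field R\<^esub>"
      using x by (intro bexI[of _ "frac_class R (\<ominus> a) b"]) (simp_all add: frac_field_simps)
  qed (auto elim!: frac_fieldE simp: frac_field_simps l_distr r_distr m_ac a_ac)
  show "Group.comm_monoid (frac_field R)"
    by (rule comm_monoidI) (auto elim!: frac_fieldE simp: frac_field_simps m_ac)
qed (elim frac_fieldE, simp add: frac_field_simps l_distr r_distr m_ac)

lemma field_frac_field: "field (frac_field R)"
proof (rule cring.cring_fieldI2[OF cring_frac_field])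
  show "\<zero>\<^bsub>frac_field R\<^esub> \<noteq> \<one>\<^bsub>frac_field R\<^esub>"
    by (simp add: frac_field_simps)
  fix x assume "x \<in> carrier (frac_field R)" and nz: "x \<noteq> \<zero>\<^bsub>frac_field R\<^esub>"
  then obtain a b where x: "a \<in> carrier R" "b \<in> carrier R" "b \<noteq> \<zero>" "x = frac_class R a b"
    by (metis frac_fieldE)
  with nz have "a \<noteq> \<zero>"
    by (auto simp: frac_field_simps)
  then show "\<exists>y\<in>carrier (frac_field R). x \<otimes>\<^bsub>frac_field R\<^esub> y = \<one>\<^bsub>frac_field R\<^esub>"
    using x by (intro bexI[of _ "frac_class R b a"]) (simp_all add: frac_field_simps m_comm)
qed

lemma frac_embed_hom: "frac_embed R \<in> ring_hom R (frac_field R)"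
  by (rule ring_hom_memI) (auto simp: frac_embed_def frac_field_simps)

end

section \<open>Fractional ideals and the class group\<close>

context cring
begin

text \<open>Stated for arbitrary sets, since fractional ideals are additive subgroups of the field
  of fractions but in general not ideals of it.\<close>

lemma ideal_prod_subset:
  assumes "\<And>i j. \<lbrakk>i \<in> I; j \<in> J\<rbrakk> \<Longrightarrow> i \<otimes> j \<in> L"
    and "\<And>x y. \<lbrakk>x \<in> L; y \<in> L\<rbrakk> \<Longrightarrow> x \<oplus> y \<in> L"
  shows "I \<cdot> J \<subseteq> L"
proof
  fix s assume "s \<in> I \<cdot> J"
  then show "s \<in> L"
    by induction (auto intro: assms)
qed

lemma ideal_prod_subset_carrier:
  assumes "I \<subseteq> carrier R" "J \<subseteq> carrier R"
  shows "I \<cdot> J \<subseteq> carrier R"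
  by (rule ideal_prod_subset) (use assms in auto)

lemma ideal_prod_commute_subset:
  assumes "I \<subseteq> carrier R" "J \<subseteq> carrier R"
  shows "I \<cdot> J = J \<cdot> I"
proof -
  have "A \<cdot> B \<subseteq> B \<cdot> A" if "A \<subseteq> carrier R" "B \<subseteq> carrier R" for A B
  proof (rule ideal_prod_subset)
    fix i j assume "i \<in> A" "j \<in> B"
    then show "i \<otimes> j \<in> B \<cdot> A"
      using that ideal_prod.prod[of j B i A R] m_comm[of i j] by (auto simp: subset_iff)
  qed (rule ideal_prod.sum)
  then show ?thesis
    using assms by blast
qed

lemma ideal_prod_assoc_subset:
  assumes "I \<subseteq> carrier R" "J \<subseteq> carrier R" "L \<subseteq> carrier R"
  shows "(I \<cdot> J) \<cdot> L = I \<cdot> (J \<cdot> L)"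
proof -
  have *: "(A \<cdot> B) \<cdot> C \<subseteq> A \<cdot> (B \<cdot> C)"
    if sub: "A \<subseteq> carrier R" "B \<subseteq> carrier R" "C \<subseteq> carrier R" for A B C
  proof (rule ideal_prod_subset)
    fix s c assume s: "s \<in> A \<cdot> B" and c: "c \<in> C"
    from s show "s \<otimes> c \<in> A \<cdot> (B \<cdot> C)"
    proof induction
      case (prod i j)
      then have "i \<otimes> (j \<otimes> c) \<in> A \<cdot> (B \<cdot> C)"
        using c by (intro ideal_prod.prod)
      then show ?case
        using prod c sub by (auto simp: m_assoc subset_iff)
    next
      case (sum s1 s2)
      then show ?case
        using ideal_prod_subset_carrier[OF sub(1,2)] sub(3) c
        by (simp add: l_distr subset_iff ideal_prod.sum)
    qed
  qed (rule ideal_prod.sum)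
  \<comment> \<open>The reverse inclusion is the proved one for the factors in reverse order,
    transported by commutativity.\<close>
  have "I \<cdot> (J \<cdot> L) = (L \<cdot> J) \<cdot> I"
    using assms by (simp add: ideal_prod_commute_subset ideal_prod_subset_carrier)
  also have "\<dots> \<subseteq> L \<cdot> (J \<cdot> I)"
    using assms by (intro *)
  also have "\<dots> = (I \<cdot> J) \<cdot> L"
    using assms by (simp add: ideal_prod_commute_subset ideal_prod_subset_carrier)
  finally show ?thesis
    using *[OF assms] by blast
qed

text \<open>Reduces inclusions of products to generators. The elements that multiply a given set
  into \<open>L\<close> form a colon ideal, so the hypothesis extends first from \<open>S\<close> to
  \<open>Idl S\<close> and then from \<open>T\<close> to \<open>Idl T\<close>.\<close>

lemma ideal_prod_genideal_subset:
  assumes "S \<subseteq> carrier R" "T \<subseteq> carrier R" and L: "ideal L R"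
    and ST: "\<And>s t. \<lbrakk>s \<in> S; t \<in> T\<rbrakk> \<Longrightarrow> s \<otimes> t \<in> L"
  shows "(Idl S) \<cdot> (Idl T) \<subseteq> L"
proof -
  interpret L: ideal L R by fact
  have colon: "ideal {a \<in> carrier R. \<forall>t\<in>U. a \<otimes> t \<in> L} R" if U: "U \<subseteq> carrier R" for U
  proof (rule idealI)
    show "subgroup {a \<in> carrier R. \<forall>t\<in>U. a \<otimes> t \<in> L} (add_monoid R)"
      using U by (intro add.subgroupI)
        (auto simp: l_distr l_minus subset_iff simp flip: a_inv_def intro!: exI[of _ \<zero>])
  next
    fix a x assume a: "a \<in> {a \<in> carrier R. \<forall>t\<in>U. a \<otimes> t \<in> L}" and x: "x \<in> carrier R"
    then show "x \<otimes> a \<in> {a \<in> carrier R. \<forall>t\<in>U. a \<otimes> t \<in> L}"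
      using U by (auto simp: m_assoc subset_iff L.I_l_closed)
    then show "a \<otimes> x \<in> {a \<in> carrier R. \<forall>t\<in>U. a \<otimes> t \<in> L}"
      using a x m_comm[of a x] by auto
  qed (rule ring_axioms)
  have sub: "Idl S \<subseteq> carrier R"
    using genideal_ideal[OF assms(1), THEN ideal.Icarr] by blast
  have "Idl S \<subseteq> {a \<in> carrier R. \<forall>t\<in>T. a \<otimes> t \<in> L}"
    using assms by (intro genideal_minimal colon) auto
  then have "t \<otimes> s \<in> L" if "t \<in> T" "s \<in> Idl S" for s t
    using that assms(2) sub m_comm[of t s] by (auto simp: subset_iff)
  then have T: "Idl T \<subseteq> {a \<in> carrier R. \<forall>s\<in>Idl S. a \<otimes> s \<in> L}"
    using assms(2) sub by (intro genideal_minimal colon sub) auto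
  show ?thesis
  proof (rule ideal_prod_subset)
    fix s t assume "s \<in> Idl S" "t \<in> Idl T"
    then show "s \<otimes> t \<in> L"
      using T sub m_comm[of s t] by (auto simp: subset_iff)
  next
    fix x y assume "x \<in> L" "y \<in> L"
    then show "x \<oplus> y \<in> L"
      by (rule additive_subgroup.a_closed[OF L.additive_subgroup_axioms])
  qed
qed

end

text \<open>An auxiliary monoid whose group of units is the group of invertible fractional ideals,
  so that the group axioms need not be checked by hand.\<close>

definition frac_ideal_monoid :: "('a, 'm) ring_scheme \<Rightarrow> ('a \<times> 'a) set set monoid" where
  "frac_ideal_monoid R =
     \<lparr>carrier = {I. fractional_ideal R I},
      monoid.mult = ideal_prod (frac_field R),
      one = frac_embed R ` carrier R\<rparr>"

context domain
begin

interpretation Q: field "frac_field R"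
  by (rule field_frac_field)

interpretation emb: ring_hom_cring R "frac_field R" "frac_embed R"
  by (intro ring_hom_cring.intro ring_hom_cring_axioms.intro is_cring cring_frac_field frac_embed_hom)

section \<open>Fractional ideals and their products\<close>

lemma fractional_idealI:
  assumes "I \<subseteq> carrier (frac_field R)" "\<zero>\<^bsub>frac_field R\<^esub> \<in> I"
    and "\<And>x y. \<lbrakk>x \<in> I; y \<in> I\<rbrakk> \<Longrightarrow> x \<oplus>\<^bsub>frac_field R\<^esub> y \<in> I"
    and smult: "\<And>r x. \<lbrakk>r \<in> carrier R; x \<in> I\<rbrakk> \<Longrightarrow> frac_embed R r \<otimes>\<^bsub>frac_field R\<^esub> x \<in> I"
    and "d \<in> carrier R" "d \<noteq> \<zero>"
    and "\<And>x. x \<in> I \<Longrightarrow> frac_embed R d \<otimes>\<^bsub>frac_field R\<^esub> x \<in> frac_embed R ` carrier R"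
  shows "fractional_ideal R I"
proof -
  \<comment> \<open>Closure under negatives comes from scalar multiplication by
    \<open>\<ominus> \<one>\<close>.\<close>
  have "\<ominus>\<^bsub>frac_field R\<^esub> x \<in> I" if "x \<in> I" for x
    using smult[of "\<ominus> \<one>" x] that assms(1) by (auto simp: Q.l_minus subset_iff)
  then have "subgroup I (add_monoid (frac_field R))"
    using assms by (intro Q.add.subgroupI) (auto simp: a_inv_def)
  then show ?thesis
    using assms unfolding fractional_ideal_def by blast
qed

lemma fractional_idealD:
  assumes "fractional_ideal R I"
  shows "I \<subseteq> carrier (frac_field R)" "\<zero>\<^bsub>frac_field R\<^esub> \<in> I"
    and "\<And>x y. \<lbrakk>x \<in> I; y \<in> I\<rbrakk> \<Longrightarrow> x \<oplus>\<^bsub>frac_field R\<^esub> y \<in> I"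
    and "\<And>r x. \<lbrakk>r \<in> carrier R; x \<in> I\<rbrakk> \<Longrightarrow> frac_embed R r \<otimes>\<^bsub>frac_field R\<^esub> x \<in> I"
  using assms unfolding fractional_ideal_def subgroup_def by auto

lemma fractional_idealE:
  assumes "fractional_ideal R I"
  obtains d where "d \<in> carrier R" "d \<noteq> \<zero>"
    "\<And>x. x \<in> I \<Longrightarrow> frac_embed R d \<otimes>\<^bsub>frac_field R\<^esub> x \<in> frac_embed R ` carrier R"
  using assms unfolding fractional_ideal_def by (metis Diff_iff singletonI)

lemma fractional_ideal_embed:
  assumes "ideal I R"
  shows "fractional_ideal R (frac_embed R ` I)"
proof -
  interpret I: ideal I R by fact
  show ?thesis
  proof (rule fractional_idealI[of _ \<one>])
    show "\<zero>\<^bsub>frac_field R\<^esub> \<in> frac_embed R ` I"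
      using I.zero_closed by (metis emb.hom_zero imageI)
  next
    fix x y assume "x \<in> frac_embed R ` I" "y \<in> frac_embed R ` I"
    then show "x \<oplus>\<^bsub>frac_field R\<^esub> y \<in> frac_embed R ` I"
      by (auto simp flip: emb.hom_add simp: I.Icarr I.a_closed)
  next
    fix r x assume "r \<in> carrier R" "x \<in> frac_embed R ` I"
    then show "frac_embed R r \<otimes>\<^bsub>frac_field R\<^esub> x \<in> frac_embed R ` I"
      by (auto simp flip: emb.hom_mult simp: I.Icarr I.I_l_closed)
  qed (auto simp: I.Icarr)
qed

text \<open>Moves products of integral ideals from the field of fractions back to \<open>R\<close>,
  where they can be checked on generators.\<close>

lemma ideal_prod_embed:
  assumes "ideal I R" "ideal J R"
  shows "ideal_prod (frac_field R) (frac_embed R ` I) (frac_embed R ` J) = frac_embed R ` (I \<cdot> J)"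
proof
  interpret I: ideal I R by fact
  interpret J: ideal J R by fact
  have sub: "I \<cdot> J \<subseteq> carrier R"
    by (rule ideal_prod_in_carrier[OF assms])
  show "ideal_prod (frac_field R) (frac_embed R ` I) (frac_embed R ` J) \<subseteq> frac_embed R ` (I \<cdot> J)"
  proof (rule Q.ideal_prod_subset)
    fix i j assume "i \<in> frac_embed R ` I" "j \<in> frac_embed R ` J"
    then show "i \<otimes>\<^bsub>frac_field R\<^esub> j \<in> frac_embed R ` (I \<cdot> J)"
      by (auto simp flip: emb.hom_mult simp: I.Icarr J.Icarr intro!: imageI ideal_prod.prod)
  next
    fix x y assume "x \<in> frac_embed R ` (I \<cdot> J)" "y \<in> frac_embed R ` (I \<cdot> J)"
    then show "x \<oplus>\<^bsub>frac_field R\<^esub> y \<in> frac_embed R ` (I \<cdot> J)"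
      using sub by (auto simp flip: emb.hom_add simp: subset_iff intro!: imageI ideal_prod.sum)
  qed
  show "frac_embed R ` (I \<cdot> J) \<subseteq> ideal_prod (frac_field R) (frac_embed R ` I) (frac_embed R ` J)"
  proof clarify
    fix s assume "s \<in> I \<cdot> J"
    then show "frac_embed R s \<in> ideal_prod (frac_field R) (frac_embed R ` I) (frac_embed R ` J)"
    proof induction
      case (prod i j)
      then show ?case
        by (simp add: I.Icarr J.Icarr ideal_prod.prod)
    next
      case (sum s1 s2)
      then show ?case
        using sub by (simp add: subset_iff ideal_prod.sum)
    qed
  qed
qed

lemma fractional_ideal_prod:
  assumes I: "fractional_ideal R I" and J: "fractional_ideal R J"
  shows "fractional_ideal R (ideal_prod (frac_field R) I J)"
proof -
  note sub = fractional_idealD(1)[OF I] fractional_idealD(1)[OF J]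
  note prod_sub = Q.ideal_prod_subset_carrier[OF sub]
  obtain c where c: "c \<in> carrier R" "c \<noteq> \<zero>"
    "\<And>x. x \<in> I \<Longrightarrow> frac_embed R c \<otimes>\<^bsub>frac_field R\<^esub> x \<in> frac_embed R ` carrier R"
    using fractional_idealE[OF I] by metis
  obtain d where d: "d \<in> carrier R" "d \<noteq> \<zero>"
    "\<And>x. x \<in> J \<Longrightarrow> frac_embed R d \<otimes>\<^bsub>frac_field R\<^esub> x \<in> frac_embed R ` carrier R"
    using fractional_idealE[OF J] by metis
  show ?thesis
  \<comment> \<open>If \<open>c\<close> clears the denominators of \<open>I\<close> and
    \<open>d\<close> those of \<open>J\<close>, their product clears those of every finite sum of
    products.\<close>
  proof (rule fractional_idealI[of _ "c \<otimes> d"])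
    have "\<zero>\<^bsub>frac_field R\<^esub> \<otimes>\<^bsub>frac_field R\<^esub> \<zero>\<^bsub>frac_field R\<^esub> \<in> ideal_prod (frac_field R) I J"
      using fractional_idealD(2) I J by (intro ideal_prod.prod)
    then show "\<zero>\<^bsub>frac_field R\<^esub> \<in> ideal_prod (frac_field R) I J"
      by simp
  next
    fix r x assume r: "r \<in> carrier R" and "x \<in> ideal_prod (frac_field R) I J"
    from this(2) show "frac_embed R r \<otimes>\<^bsub>frac_field R\<^esub> x \<in> ideal_prod (frac_field R) I J"
    proof induction
      case (prod i j)
      then have "(frac_embed R r \<otimes>\<^bsub>frac_field R\<^esub> i) \<otimes>\<^bsub>frac_field R\<^esub> j \<in> ideal_prod (frac_field R) I J"
        using r I by (intro ideal_prod.prod fractional_idealD(4))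
      then show ?case
        using r prod sub by (simp add: Q.m_assoc subset_iff)
    next
      case (sum s1 s2)
      then show ?case
        using r prod_sub by (simp add: Q.r_distr subset_iff ideal_prod.sum)
    qed
  next
    fix x assume "x \<in> ideal_prod (frac_field R) I J"
    then show "frac_embed R (c \<otimes> d) \<otimes>\<^bsub>frac_field R\<^esub> x \<in> frac_embed R ` carrier R"
    proof induction
      case (prod i j)
      obtain a b where ab: "a \<in> carrier R" "b \<in> carrier R" 
        "frac_embed R c \<otimes>\<^bsub>frac_field R\<^esub> i = frac_embed R a"
        "frac_embed R d \<otimes>\<^bsub>frac_field R\<^esub> j = frac_embed R b"
        using c(3)[OF prod(1)] d(3)[OF prod(2)] by blast
      have "frac_embed R (c \<otimes> d) \<otimes>\<^bsub>frac_field R\<^esub> (i \<otimes>\<^bsub>frac_field R\<^esub> j) =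
         (frac_embed R c \<otimes>\<^bsub>frac_field R\<^esub> i) \<otimes>\<^bsub>frac_field R\<^esub> (frac_embed R d \<otimes>\<^bsub>frac_field R\<^esub> j)"
        using c d prod sub by (simp add: subset_iff Q.m_ac)
      also have "\<dots> = frac_embed R (a \<otimes> b)"
        using ab by simp
      finally show ?case
        using ab by blast
    next
      case (sum s1 s2)
      then obtain a b where ab: "a \<in> carrier R" "b \<in> carrier R" 
        "frac_embed R (c \<otimes> d) \<otimes>\<^bsub>frac_field R\<^esub> s1 = frac_embed R a"
        "frac_embed R (c \<otimes> d) \<otimes>\<^bsub>frac_field R\<^esub> s2 = frac_embed R b"
        by blast
      have "frac_embed R (c \<otimes> d) \<otimes>\<^bsub>frac_field R\<^esub> (s1 \<oplus>\<^bsub>frac_field R\<^esub> s2) = frac_embed R (a \<oplus> b)"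
        using ab c d sum prod_sub by (simp add: subset_iff Q.r_distr del: emb.hom_mult)
      then show ?case
        using ab by blast
    qed
  qed (use c d prod_sub in \<open>auto simp: integral_iff intro: ideal_prod.sum\<close>)
qed

lemma ideal_prod_embed_carrier:
  assumes I: "fractional_ideal R I"
  shows "ideal_prod (frac_field R) (frac_embed R ` carrier R) I = I"
proof
  note sub = fractional_idealD(1)[OF I]
  show "ideal_prod (frac_field R) (frac_embed R ` carrier R) I \<subseteq> I"
    by (rule Q.ideal_prod_subset) (auto intro: fractional_idealD[OF I])
  show "I \<subseteq> ideal_prod (frac_field R) (frac_embed R ` carrier R) I"
  proof
    fix x assume x: "x \<in> I"
    then have "frac_embed R \<one> \<otimes>\<^bsub>frac_field R\<^esub> x \<in> ideal_prod (frac_field R) (frac_embed R ` carrier R) I"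
      by (intro ideal_prod.prod imageI one_closed)
    then show "x \<in> ideal_prod (frac_field R) (frac_embed R ` carrier R) I"
      using x sub by (auto simp: subset_iff)
  qed
qed

lemma comm_monoid_frac_ideal_monoid: "Group.comm_monoid (frac_ideal_monoid R)"
proof (rule comm_monoidI)
  show "\<one>\<^bsub>frac_ideal_monoid R\<^esub> \<in> carrier (frac_ideal_monoid R)"
    using fractional_ideal_embed[OF oneideal] by (simp add: frac_ideal_monoid_def)
next
  fix I J L
  assume "I \<in> carrier (frac_ideal_monoid R)" "J \<in> carrier (frac_ideal_monoid R)"
    "L \<in> carrier (frac_ideal_monoid R)"
  then show "I \<otimes>\<^bsub>frac_ideal_monoid R\<^esub> J \<otimes>\<^bsub>frac_ideal_monoid R\<^esub> L =
      I \<otimes>\<^bsub>frac_ideal_monoid R\<^esub> (J \<otimes>\<^bsub>frac_ideal_monoid R\<^esub> L)"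
    by (simp add: frac_ideal_monoid_def Q.ideal_prod_assoc_subset fractional_idealD(1))
next
  fix I J
  assume "I \<in> carrier (frac_ideal_monoid R)" "J \<in> carrier (frac_ideal_monoid R)"
  then show "I \<otimes>\<^bsub>frac_ideal_monoid R\<^esub> J = J \<otimes>\<^bsub>frac_ideal_monoid R\<^esub> I"
    using Q.ideal_prod_commute_subset[of I J] by (simp add: frac_ideal_monoid_def fractional_idealD(1))
qed (simp_all add: frac_ideal_monoid_def fractional_ideal_prod ideal_prod_embed_carrier)

text \<open>\<open>Units\<close> asks for a two-sided inverse and
  \<open>invertible_frac_ideals\<close> for a one-sided one; commutativity of the product identifies
  the two.\<close>

lemma invertible_frac_ideals_eq_units_of:
  "invertible_frac_ideals R = units_of (frac_ideal_monoid R)"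
proof -
  have "ideal_prod (frac_field R) I J = ideal_prod (frac_field R) J I"
    if "fractional_ideal R I" "fractional_ideal R J" for I J
    by (intro Q.ideal_prod_commute_subset fractional_idealD(1) that)
  then have "I \<in> Units (frac_ideal_monoid R) \<longleftrightarrow> I \<in> carrier (invertible_frac_ideals R)" for I
    by (simp add: Units_def frac_ideal_monoid_def invertible_frac_ideals_def) metis
  then have "Units (frac_ideal_monoid R) = carrier (invertible_frac_ideals R)"
    by blast
  then have "units_of (frac_ideal_monoid R) =
      \<lparr>carrier = carrier (invertible_frac_ideals R), monoid.mult = ideal_prod (frac_field R),
       one = frac_embed R ` carrier R\<rparr>"
    by (simp add: units_of_def frac_ideal_monoid_def)
  then show ?thesis
    by (simp only: invertible_frac_ideals_def partial_object.select_convs)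
qed

lemma comm_group_invertible_frac_ideals: "comm_group (invertible_frac_ideals R)"
  unfolding invertible_frac_ideals_eq_units_of
  by (rule Group.comm_monoid.units_comm_group[OF comm_monoid_frac_ideal_monoid])

section \<open>Principal fractional ideals and the subgroup they form\<close>

lemma fractional_ideal_principal:
  assumes "z \<in> carrier (frac_field R)"
  shows "fractional_ideal R (z <#\<^bsub>frac_field R\<^esub> (frac_embed R ` carrier R))"
proof -
  obtain a b where z: "a \<in> carrier R" "b \<in> carrier R" "b \<noteq> \<zero>" "z = frac_class R a b"
    using assms by (rule frac_fieldE)
  \<comment> \<open>The denominator \<open>b\<close> of the generator serves as common denominator
    of the whole ideal.\<close>
  have bz: "frac_embed R b \<otimes>\<^bsub>frac_field R\<^esub> z = frac_embed R a"
    using z by (simp add: frac_embed_def frac_field_simps m_comm)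
  show ?thesis
  proof (rule fractional_idealI[of _ b])
    have "z \<otimes>\<^bsub>frac_field R\<^esub> frac_embed R \<zero> \<in> z <#\<^bsub>frac_field R\<^esub> (frac_embed R ` carrier R)"
      unfolding l_coset_def by blast
    then show "\<zero>\<^bsub>frac_field R\<^esub> \<in> z <#\<^bsub>frac_field R\<^esub> (frac_embed R ` carrier R)"
      using assms by simp
  next
    fix x y
    assume "x \<in> z <#\<^bsub>frac_field R\<^esub> (frac_embed R ` carrier R)"
      "y \<in> z <#\<^bsub>frac_field R\<^esub> (frac_embed R ` carrier R)"
    then obtain r s where rs: "r \<in> carrier R" "s \<in> carrier R"
      "x = z \<otimes>\<^bsub>frac_field R\<^esub> frac_embed R r" "y = z \<otimes>\<^bsub>frac_field R\<^esub> frac_embed R s"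
      unfolding l_coset_def by blast
    then have "x \<oplus>\<^bsub>frac_field R\<^esub> y = z \<otimes>\<^bsub>frac_field R\<^esub> frac_embed R (r \<oplus> s)"
      using assms by (simp add: Q.r_distr)
    then show "x \<oplus>\<^bsub>frac_field R\<^esub> y \<in> z <#\<^bsub>frac_field R\<^esub> (frac_embed R ` carrier R)"
      using rs unfolding l_coset_def by blast
  next
    fix r x
    assume r: "r \<in> carrier R" and "x \<in> z <#\<^bsub>frac_field R\<^esub> (frac_embed R ` carrier R)"
    then obtain s where s: "s \<in> carrier R" "x = z \<otimes>\<^bsub>frac_field R\<^esub> frac_embed R s"
      unfolding l_coset_def by blast
    then have "frac_embed R r \<otimes>\<^bsub>frac_field R\<^esub> x = z \<otimes>\<^bsub>frac_field R\<^esub> frac_embed R (r \<otimes> s)"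
      using assms r by (simp add: Q.m_ac)
    then show "frac_embed R r \<otimes>\<^bsub>frac_field R\<^esub> x \<in> z <#\<^bsub>frac_field R\<^esub> (frac_embed R ` carrier R)"
      using r s unfolding l_coset_def by blast
  next
    fix x assume "x \<in> z <#\<^bsub>frac_field R\<^esub> (frac_embed R ` carrier R)"
    then obtain s where s: "s \<in> carrier R" "x = z \<otimes>\<^bsub>frac_field R\<^esub> frac_embed R s"
      unfolding l_coset_def by blast
    then have "frac_embed R b \<otimes>\<^bsub>frac_field R\<^esub> x = frac_embed R (a \<otimes> s)"
      using assms z bz by (simp flip: Q.m_assoc)
    then show "frac_embed R b \<otimes>\<^bsub>frac_field R\<^esub> x \<in> frac_embed R ` carrier R"
      using s z by blast
  qed (use assms z in \<open>auto simp: l_coset_def\<close>)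
qed

text \<open>Multiplying by a principal fractional ideal is scaling, since \<open>I\<close> already
  absorbs scalars from \<open>R\<close>.\<close>

lemma ideal_prod_principal:
  assumes z: "z \<in> carrier (frac_field R)" and I: "fractional_ideal R I"
  shows "ideal_prod (frac_field R) (z <#\<^bsub>frac_field R\<^esub> (frac_embed R ` carrier R)) I
    = z <#\<^bsub>frac_field R\<^esub> I"
proof
  note sub = fractional_idealD(1)[OF I]
  show "ideal_prod (frac_field R) (z <#\<^bsub>frac_field R\<^esub> (frac_embed R ` carrier R)) I
    \<subseteq> z <#\<^bsub>frac_field R\<^esub> I"
  proof (rule Q.ideal_prod_subset)
    fix i j assume "i \<in> z <#\<^bsub>frac_field R\<^esub> (frac_embed R ` carrier R)" and j: "j \<in> I"
    then obtain s where s: "s \<in> carrier R" "i = z \<otimes>\<^bsub>frac_field R\<^esub> frac_embed R s"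
      unfolding l_coset_def by blast
    then have "i \<otimes>\<^bsub>frac_field R\<^esub> j = z \<otimes>\<^bsub>frac_field R\<^esub> (frac_embed R s \<otimes>\<^bsub>frac_field R\<^esub> j)"
      using z j sub by (simp add: Q.m_assoc subset_iff)
    then show "i \<otimes>\<^bsub>frac_field R\<^esub> j \<in> z <#\<^bsub>frac_field R\<^esub> I"
      using fractional_idealD(4)[OF I s(1) j] unfolding l_coset_def by blast
  next
    fix x y assume "x \<in> z <#\<^bsub>frac_field R\<^esub> I" "y \<in> z <#\<^bsub>frac_field R\<^esub> I"
    then obtain r s where rs: "r \<in> I" "s \<in> I"
      "x = z \<otimes>\<^bsub>frac_field R\<^esub> r" "y = z \<otimes>\<^bsub>frac_field R\<^esub> s"
      unfolding l_coset_def by blast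
    then have "x \<oplus>\<^bsub>frac_field R\<^esub> y = z \<otimes>\<^bsub>frac_field R\<^esub> (r \<oplus>\<^bsub>frac_field R\<^esub> s)"
      using z sub by (simp add: Q.r_distr subset_iff)
    then show "x \<oplus>\<^bsub>frac_field R\<^esub> y \<in> z <#\<^bsub>frac_field R\<^esub> I"
      using fractional_idealD(3)[OF I rs(1,2)] unfolding l_coset_def by blast
  qed
  show "z <#\<^bsub>frac_field R\<^esub> I
    \<subseteq> ideal_prod (frac_field R) (z <#\<^bsub>frac_field R\<^esub> (frac_embed R ` carrier R)) I"
  proof
    fix x assume "x \<in> z <#\<^bsub>frac_field R\<^esub> I"
    then obtain i where i: "i \<in> I" "x = z \<otimes>\<^bsub>frac_field R\<^esub> i"
      unfolding l_coset_def by blast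
    have "z \<otimes>\<^bsub>frac_field R\<^esub> frac_embed R \<one> \<in> z <#\<^bsub>frac_field R\<^esub> (frac_embed R ` carrier R)"
      unfolding l_coset_def by blast
    then have "z \<in> z <#\<^bsub>frac_field R\<^esub> (frac_embed R ` carrier R)"
      using z by simp
    with i show "x \<in> ideal_prod (frac_field R) (z <#\<^bsub>frac_field R\<^esub> (frac_embed R ` carrier R)) I"
      by (auto intro: ideal_prod.prod)
  qed
qed

lemma ideal_prod_principal_principal:
  assumes "z \<in> carrier (frac_field R)" "w \<in> carrier (frac_field R)"
  shows "ideal_prod (frac_field R) (z <#\<^bsub>frac_field R\<^esub> (frac_embed R ` carrier R))
      (w <#\<^bsub>frac_field R\<^esub> (frac_embed R ` carrier R))
    = (z \<otimes>\<^bsub>frac_field R\<^esub> w) <#\<^bsub>frac_field R\<^esub> (frac_embed R ` carrier R)"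
  using assms unfolding ideal_prod_principal[OF assms(1) fractional_ideal_principal[OF assms(2)]]
  by (auto simp: l_coset_def Q.m_assoc)

lemma principal_one:
  "\<one>\<^bsub>frac_field R\<^esub> <#\<^bsub>frac_field R\<^esub> (frac_embed R ` carrier R) = frac_embed R ` carrier R"
  by (auto simp: l_coset_def)

lemma principal_inverse:
  assumes "z \<in> carrier (frac_field R) - {\<zero>\<^bsub>frac_field R\<^esub>}"
  shows "ideal_prod (frac_field R) (inv\<^bsub>frac_field R\<^esub> z <#\<^bsub>frac_field R\<^esub> (frac_embed R ` carrier R))
      (z <#\<^bsub>frac_field R\<^esub> (frac_embed R ` carrier R)) = frac_embed R ` carrier R"
  using assms
  by (simp add: ideal_prod_principal_principal Q.field_Units Q.Units_l_inv principal_one)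

lemma principal_invertible:
  assumes "z \<in> carrier (frac_field R) - {\<zero>\<^bsub>frac_field R\<^esub>}"
  shows "z <#\<^bsub>frac_field R\<^esub> (frac_embed R ` carrier R) \<in> carrier (invertible_frac_ideals R)"
proof -
  have inv: "inv\<^bsub>frac_field R\<^esub> z \<in> carrier (frac_field R)"
    using assms by (simp add: Q.field_Units)
  then show ?thesis
    using principal_inverse[OF assms] assms fractional_ideal_principal[OF inv]
      fractional_ideal_principal[of z]
    by (auto simp: invertible_frac_ideals_def Q.ideal_prod_commute_subset fractional_idealD(1)
        intro!: exI[of _ "inv\<^bsub>frac_field R\<^esub> z <#\<^bsub>frac_field R\<^esub> (frac_embed R ` carrier R)"])
qed

lemma subgroup_principal_frac_ideals:
  "subgroup (principal_frac_ideals R) (invertible_frac_ideals R)"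
proof -
  interpret G: comm_group "invertible_frac_ideals R"
    by (rule comm_group_invertible_frac_ideals)
  show ?thesis
  proof (rule G.subgroupI)
    show "principal_frac_ideals R \<subseteq> carrier (invertible_frac_ideals R)"
      using principal_invertible by (auto simp: principal_frac_ideals_def)
    show "principal_frac_ideals R \<noteq> {}"
      using Q.one_closed Q.one_not_zero unfolding principal_frac_ideals_def by blast
  next
    fix P assume "P \<in> principal_frac_ideals R"
    then obtain z where z: "z \<in> carrier (frac_field R) - {\<zero>\<^bsub>frac_field R\<^esub>}"
      "P = z <#\<^bsub>frac_field R\<^esub> (frac_embed R ` carrier R)"
      by (auto simp: principal_frac_ideals_def)
    have inv: "inv\<^bsub>frac_field R\<^esub> z \<in> carrier (frac_field R) - {\<zero>\<^bsub>frac_field R\<^esub>}"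
      using z Q.Units_inv_Units[of z] Q.field_Units by simp
    have "inv\<^bsub>invertible_frac_ideals R\<^esub> P =
        inv\<^bsub>frac_field R\<^esub> z <#\<^bsub>frac_field R\<^esub> (frac_embed R ` carrier R)"
      using principal_inverse[OF z(1)] principal_invertible[OF z(1)] principal_invertible[OF inv] z(2)
      by (intro G.inv_equality) (auto simp: invertible_frac_ideals_def)
    then show "inv\<^bsub>invertible_frac_ideals R\<^esub> P \<in> principal_frac_ideals R"
      using inv unfolding principal_frac_ideals_def by blast
  next
    fix P P' assume "P \<in> principal_frac_ideals R" "P' \<in> principal_frac_ideals R"
    then obtain z w where zw: "z \<in> carrier (frac_field R) - {\<zero>\<^bsub>frac_field R\<^esub>}"
      "P = z <#\<^bsub>frac_field R\<^esub> (frac_embed R ` carrier R)"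
      "w \<in> carrier (frac_field R) - {\<zero>\<^bsub>frac_field R\<^esub>}"
      "P' = w <#\<^bsub>frac_field R\<^esub> (frac_embed R ` carrier R)"
      by (auto simp: principal_frac_ideals_def)
    then have "P \<otimes>\<^bsub>invertible_frac_ideals R\<^esub> P' =
      (z \<otimes>\<^bsub>frac_field R\<^esub> w) <#\<^bsub>frac_field R\<^esub> (frac_embed R ` carrier R)"
      by (simp add: invertible_frac_ideals_def ideal_prod_principal_principal)
    moreover have "z \<otimes>\<^bsub>frac_field R\<^esub> w \<in> carrier (frac_field R) - {\<zero>\<^bsub>frac_field R\<^esub>}"
      using zw by (simp add: Q.integral_iff)
    ultimately show "P \<otimes>\<^bsub>invertible_frac_ideals R\<^esub> P' \<in> principal_frac_ideals R"
      unfolding principal_frac_ideals_def by blast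
  qed
qed

section \<open>Classes of integral ideals\<close>

lemma embed_cgenideal:
  assumes "a \<in> carrier R"
  shows "frac_embed R ` (PIdl a) = frac_embed R a <#\<^bsub>frac_field R\<^esub> (frac_embed R ` carrier R)"
proof -
  have "PIdl a = (\<lambda>r. a \<otimes> r) ` carrier R"
    using assms by (auto simp: cgenideal_def m_comm)
  then show ?thesis
    using assms by (auto simp: l_coset_def image_iff)
qed

lemma frac_embed_nonzero:
  assumes "a \<in> carrier R" "a \<noteq> \<zero>"
  shows "frac_embed R a \<in> carrier (frac_field R) - {\<zero>\<^bsub>frac_field R\<^esub>}"
  using assms by (simp add: frac_embed_def frac_field_simps)

text \<open>If the product of \<open>I\<close> and \<open>J\<close> is generated by
  \<open>a\<close>, then \<open>J\<close> scaled by the inverse of \<open>a\<close> in the field of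
  fractions is an inverse of \<open>I\<close>.\<close>

lemma embed_invertible:
  assumes "ideal I R" "ideal J R" "I \<cdot> J = PIdl a" "a \<in> carrier R" "a \<noteq> \<zero>"
  shows "frac_embed R ` I \<in> carrier (invertible_frac_ideals R)"
proof -
  define z where "z = inv\<^bsub>frac_field R\<^esub> (frac_embed R a)"
  note a = frac_embed_nonzero[OF assms(4,5)]
  then have z: "z \<in> carrier (frac_field R)"
    by (simp add: z_def Q.field_Units)
  note fr = fractional_ideal_embed[OF assms(1)] fractional_ideal_embed[OF assms(2)]
    fractional_ideal_principal[OF z]
  let ?Z = "z <#\<^bsub>frac_field R\<^esub> (frac_embed R ` carrier R)"
  note sub = fr[THEN fractional_idealD(1)]
  have "ideal_prod (frac_field R) (frac_embed R ` I) (ideal_prod (frac_field R) (frac_embed R ` J) ?Z) =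
     ideal_prod (frac_field R) (frac_embed R ` (PIdl a)) ?Z"
    using sub by (simp add: Q.ideal_prod_assoc_subset[symmetric] ideal_prod_embed assms(1-3))
  also have "\<dots> = ideal_prod (frac_field R) ?Z (frac_embed R ` (PIdl a))"
    using sub(3) fractional_idealD(1)[OF fractional_ideal_embed[OF cgenideal_ideal[OF assms(4)]]]
    by (intro Q.ideal_prod_commute_subset)
  also have "\<dots> = ideal_prod (frac_field R) ?Z
     (frac_embed R a <#\<^bsub>frac_field R\<^esub> (frac_embed R ` carrier R))"
    by (simp only: embed_cgenideal[OF assms(4)])
  also have "\<dots> = frac_embed R ` carrier R"
    unfolding z_def by (rule principal_inverse[OF a])
  finally show ?thesis
    using fr fractional_ideal_prod[OF fr(2,3)] by (auto simp: invertible_frac_ideals_def)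
qed

lemma ideal_class_closed:
  assumes "ideal I R" "ideal J R" "I \<cdot> J = PIdl a" "a \<in> carrier R" "a \<noteq> \<zero>"
  shows "ideal_class R I \<in> carrier (ideal_class_group R)"
  using embed_invertible[OF assms]
  by (auto simp: ideal_class_def ideal_class_group_def carrier_FactGroup)

text \<open>The factor generated by \<open>a\<close> embeds into the subgroup of principal
  fractional ideals, so its coset absorbs it and only the class of \<open>L\<close> remains.\<close>

lemma ideal_class_mult:
  assumes "ideal I R" "ideal J R" "ideal L R" "a \<in> carrier R" "a \<noteq> \<zero>"
    and IJ: "I \<cdot> J = (PIdl a) \<cdot> L"
    and inv: "frac_embed R ` I \<in> carrier (invertible_frac_ideals R)"
      "frac_embed R ` J \<in> carrier (invertible_frac_ideals R)"
      "frac_embed R ` L \<in> carrier (invertible_frac_ideals R)"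
  shows "ideal_class R I \<otimes>\<^bsub>ideal_class_group R\<^esub> ideal_class R J = ideal_class R L"
proof -
  interpret G: comm_group "invertible_frac_ideals R"
    by (rule comm_group_invertible_frac_ideals)
  interpret P: normal "principal_frac_ideals R" "invertible_frac_ideals R"
    by (intro G.subgroup_imp_normal subgroup_principal_frac_ideals)
  have P: "frac_embed R ` (PIdl a) \<in> principal_frac_ideals R"
    using embed_cgenideal[OF assms(4)] frac_embed_nonzero[OF assms(4,5)]
    unfolding principal_frac_ideals_def by blast
  have "frac_embed R ` I \<otimes>\<^bsub>invertible_frac_ideals R\<^esub> frac_embed R ` J
     = frac_embed R ` (PIdl a) \<otimes>\<^bsub>invertible_frac_ideals R\<^esub> frac_embed R ` L"
    using assms by (simp add: invertible_frac_ideals_def ideal_prod_embed cgenideal_ideal)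
  moreover have "ideal_class R I \<otimes>\<^bsub>ideal_class_group R\<^esub> ideal_class R J =
    principal_frac_ideals R #>\<^bsub>invertible_frac_ideals R\<^esub>
      (frac_embed R ` I \<otimes>\<^bsub>invertible_frac_ideals R\<^esub> frac_embed R ` J)"
    using inv by (simp add: ideal_class_def ideal_class_group_def P.rcos_sum)
  moreover have "principal_frac_ideals R #>\<^bsub>invertible_frac_ideals R\<^esub>
      (frac_embed R ` (PIdl a) \<otimes>\<^bsub>invertible_frac_ideals R\<^esub> frac_embed R ` L) = ideal_class R L"
    using inv P P.rcos_const[OF G.is_group P] P.subset
    by (simp add: ideal_class_def subset_iff flip: G.coset_mult_assoc)
  ultimately show ?thesis
    by simp
qed

end

section \<open>Bezout identities and Mumford representations\<close>

text \<open>The extended Euclidean algorithm, phrased with a combination dividing both entries; this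
  avoids choosing a normalised gcd.\<close>

lemma euclidean_bezout:
  fixes a b :: "'a::euclidean_ring"
  shows "\<exists>r s. r * a + s * b dvd a \<and> r * a + s * b dvd b"
proof (induction "euclidean_size b" arbitrary: a b rule: less_induct)
  case less
  show ?case
  proof (cases "b = 0")
    case True
    then show ?thesis
      by (intro exI[of _ 1] exI[of _ 0]) simp
  next
    case False
    then have "euclidean_size (a mod b) < euclidean_size b"
      by (rule mod_size_less)
    then obtain r s where *: "r * b + s * (a mod b) dvd b" "r * b + s * (a mod b) dvd a mod b"
      using less[of "a mod b" b] by blast
    then have "r * b + s * (a mod b) dvd a"
      using dvd_mod_iff[OF *(1)] by blast
    \<comment> \<open>Coefficients for the pair \<open>b\<close>, \<open>a mod b\<close> become
      coefficients for \<open>a\<close>, \<open>b\<close> by writing the remainder as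
      \<open>a - (a div b) * b\<close>.\<close>
    moreover have "r * b + s * (a mod b) = s * a + (r - s * (a div b)) * b"
      by (simp add: algebra_simps flip: minus_mult_div_eq_mod)
    ultimately show ?thesis
      using *(1) by metis
  qed
qed

lemma coprime_bezout:
  fixes a b :: "'a::euclidean_ring"
  assumes "coprime a b"
  obtains r s where "r * a + s * b = 1"
proof -
  obtain r s where "r * a + s * b dvd a" "r * a + s * b dvd b"
    using euclidean_bezout by blast
  then have "is_unit (r * a + s * b)"
    using assms coprime_common_divisor by blast
  then obtain u where "1 = (r * a + s * b) * u"
    by (rule dvdE)
  then have "(u * r) * a + (u * s) * b = 1"
    by (simp add: algebra_simps)
  then show thesis
    by (rule that)
qed

text \<open>Provides step (1) of the addition law. In a factorisation \<open>f = c * e\<close> with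
  \<open>c dvd p\<close>, a unit \<open>e\<close> would make \<open>f\<close> divide the nonzero
  \<open>p\<close> of smaller degree, so \<open>c\<close> is the unit.\<close>

lemma irreducible_bezout_degree:
  fixes f p :: "'a::field poly"
  assumes "irreducible f" "p \<noteq> 0" "degree p < degree f"
  obtains r s where "r * f + s * p = 1"
proof -
  have "coprime f p"
  proof (rule coprimeI)
    fix c assume "c dvd f" "c dvd p"
    then obtain e where e: "f = c * e"
      by blast
    have "\<not> is_unit e"
    proof
      assume "is_unit e"
      then have "f dvd p"
        using \<open>c dvd p\<close> e by (simp add: mult_unit_dvd_iff)
      then show False
        using assms(2,3) dvd_imp_degree_le[of f p] by simp
    qed
    then show "is_unit c"
      using irreducibleD[OF assms(1) e] by blast
  qed
  then show thesis
    using coprime_bezout that by blast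
qed

text \<open>The norm of \<open>s - h\<close>, where \<open>s\<^sup>2 = x\<close>, is \<open>h\<^sup>2 - x\<close>; by multiplicativity the one belonging to \<open>h3\<close> is again a unit modulo \<open>f\<close>.\<close>

lemma bezout_sum:
  fixes f h1 h2 h3 x :: "'a::idom"
  assumes "a1 * f + b1 * (x - h1\<^sup>2) = 1" "a2 * f + b2 * (x - h2\<^sup>2) = 1"
    and "g1 * f + g2 * (h1 + h2) = 1" "h3 = g2 * (h1 * h2 + x) + k * f"
  shows "\<exists>r s. r * f + s * (x - h3\<^sup>2) = 1"
proof -
  \<comment> \<open>Multiplying the formula for \<open>h3\<close> by \<open>h1 + h2\<close> and
    replacing \<open>g2 * (h1 + h2)\<close> by \<open>1 - g1 * f\<close> leaves exactly the multiple
    \<open>w * f\<close> as error term.\<close>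
  define w where "w = (h1 + h2) * k - g1 * (h1 * h2 + x)"
  have w: "(h1 + h2) * h3 = h1 * h2 + x + w * f"
    using assms(3,4) unfolding w_def by Groebner_Basis.algebra
  \<comment> \<open>The coefficients arise by multiplying the two Bezout identities and using
    \<open>(x - h1\<^sup>2) * (x - h2\<^sup>2) = (h1 * h2 + x)\<^sup>2 - x * (h1 +
    h2)\<^sup>2\<close>, with \<open>h1 * h2 + x\<close> replaced by means of
    \<open>w\<close>.\<close>
  have "(a1 + a2 - a1 * a2 * f - b1 * b2 * (w * (2 * (h1 * h2 + x) + w * f))) * f
      + (- b1 * b2 * (h1 + h2)\<^sup>2) * (x - h3\<^sup>2) = 1"
    using assms(1,2) w by Groebner_Basis.algebra
  then show ?thesis
    by blast
qed

section \<open>Mumford conditions over the algebraic closure\<close>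

lemma map_poly_to_ac_add: "map_poly to_ac (p + q) = map_poly to_ac p + map_poly to_ac q"
  by (rule poly_eqI) (simp add: coeff_map_poly)

lemma map_poly_to_ac_mult: "map_poly to_ac (p * q) = map_poly to_ac p * map_poly to_ac q"
  by (rule poly_eqI) (simp add: coeff_map_poly coeff_mult to_ac_sum)

text \<open>The quotient in the third condition is \<open>[:0, 1:] - h\<^sup>2\<close>. Evaluating
  the Bezout identity at a root common to it and \<open>f\<close> would give \<open>0 = 1\<close>,
  so no singular point can violate the condition.\<close>

lemma mumford_rep_nodal:
  fixes f h :: "'a::field poly"
  assumes f: "degree f > 0" and h: "h = 0 \<or> degree h < degree f"
    and rs: "r * f + s * ([:0, 1:] - h\<^sup>2) = 1"
  shows "mumford_rep f (f\<^sup>2) (h * f)"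
proof -
  have nz: "f \<noteq> 0"
    using f by auto
  have deg: "h * f = 0 \<or> degree (h * f) < degree (f\<^sup>2)"
    using nz h degree_mult_le[of h f] by (auto simp: degree_mult_eq power2_eq_square)
  have eq: "[:0, 1:] * f\<^sup>2 - (h * f)\<^sup>2 = ([:0, 1:] - h\<^sup>2) * f\<^sup>2"
    by (simp add: algebra_simps power2_eq_square)
  have dvd: "f\<^sup>2 dvd (h * f)\<^sup>2 - [:0, 1:] * f\<^sup>2"
    using eq by (metis dvd_minus_iff dvd_triv_right minus_diff_eq)
  have quot: "([:0, 1:] * f\<^sup>2 - (h * f)\<^sup>2) div f\<^sup>2 = [:0, 1:] - h\<^sup>2"
    using nz unfolding eq by simp
  have False
    if "[:-a, 1:] dvd map_poly to_ac (f\<^sup>2)" "[:-a, 1:] dvd map_poly to_ac ([:0, 1:] - h\<^sup>2)" for a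
  proof -
    let ?ev = "\<lambda>p. poly (map_poly to_ac p) a"
    have "?ev (f\<^sup>2) = 0" and g: "?ev ([:0, 1:] - h\<^sup>2) = 0"
      using that by (simp_all only: poly_eq_0_iff_dvd)
    then have "?ev f = 0"
      by (simp add: power2_eq_square map_poly_to_ac_mult)
    with g have "?ev (r * f + s * ([:0, 1:] - h\<^sup>2)) = 0"
      by (simp only: map_poly_to_ac_add map_poly_to_ac_mult poly_add poly_mult) simp
    then show False
      by (simp add: rs)
  qed
  then show ?thesis
    unfolding mumford_rep_def quot using nz deg dvd by auto
qed

section \<open>The coordinate ring of the nodal curve\<close>

abbreviation nodal_poly :: "'a::field poly \<Rightarrow> 'a poly poly" where
  "nodal_poly f \<equiv> [:0, 1:]\<^sup>2 - [:[:0, 1:] * f\<^sup>2:]"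

text \<open>Turns computations with cosets into divisibility of polynomials in \<open>y\<close> over
  \<open>k[x]\<close>.\<close>

lemma nodal_ideal_eq: "nodal_ideal f = {p. nodal_poly f dvd p}"
proof -
  interpret P: cring "ring_of_type_algebra :: 'a poly poly ring" ..
  show ?thesis
    unfolding nodal_ideal_def
    by (subst P.cgenideal_eq_genideal[symmetric])
      (auto simp: ring_of_type_algebra_def cgenideal_def dvd_def mult.commute)
qed

lemma ideal_nodal_ideal: "ideal (nodal_ideal f) ring_of_type_algebra"
  unfolding nodal_ideal_def
  by (intro ring.genideal_ideal ring_from_type_algebra) (simp add: ring_of_type_algebra_def)

text \<open>Division with remainder by a monic quadratic in \<open>y\<close>. As the coefficient
  ring \<open>k[x]\<close> is not a field, the remainder is built by induction in Horner
  form.\<close>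

lemma nodal_reduce:
  fixes f :: "'a::field poly"
  shows "\<exists>a b. nodal_poly f dvd p - [:a, b:]"
proof (induction p)
  case 0
  show ?case
    by (intro exI[of _ 0]) simp
next
  case (pCons c p)
  then obtain a b where "nodal_poly f dvd p - [:a, b:]"
    by blast
  \<comment> \<open>Multiplying the remainder \<open>a + b y\<close> by \<open>y\<close> creates
    \<open>b y\<^sup>2\<close>, which the added multiple of the curve equation replaces by
    \<open>b x f\<^sup>2\<close>.\<close>
  then have "nodal_poly f dvd [:0, 1:] * (p - [:a, b:]) + [:b:] * nodal_poly f"
    by (intro dvd_add dvd_mult dvd_refl)
  also have "[:0, 1:] * (p - [:a, b:]) + [:b:] * nodal_poly f =
      pCons c p - [:c + [:0, 1:] * f\<^sup>2 * b, a:]"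
    by (simp add: power2_eq_square mult.commute)
  finally show ?case
    by blast
qed

text \<open>Gives uniqueness of the remainders above, because the divisor is monic of degree 2 in
  \<open>y\<close>.\<close>

lemma nodal_dvd_linear:
  fixes f :: "'a::field poly"
  assumes "nodal_poly f dvd [:a, b:]"
  shows "a = 0 \<and> b = 0"
proof -
  have "nodal_poly f = [:- ([:0, 1:] * f\<^sup>2), 0, 1:]"
    by (simp add: power2_eq_square)
  then have deg: "degree (nodal_poly f) = 2"
    by simp
  have "degree [:a, b:] < 2"
    by (simp add: degree_pCons_eq_if)
  then have "[:a, b:] = 0"
    using dvd_imp_degree_le[OF assms] deg by force
  then show ?thesis
    by simp
qed

text \<open>A parity argument: for nonzero \<open>b\<close> the right-hand side has odd degree in
  \<open>x\<close>, whereas a nonzero square has even degree.\<close>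

lemma nodal_norm_eq_0:
  fixes f :: "'a::field poly"
  assumes "f \<noteq> 0" and eq: "a\<^sup>2 = [:0, 1:] * f\<^sup>2 * b\<^sup>2"
  shows "a = 0 \<and> b = 0"
proof -
  have "b = 0"
  proof (rule ccontr)
    assume "b \<noteq> 0"
    moreover from this have "a \<noteq> 0"
      using eq assms(1) by auto
    ultimately have "2 * degree a = 1 + 2 * degree f + 2 * degree b"
      using arg_cong[OF eq, of degree] assms(1) by (simp add: degree_mult_eq degree_power_eq)
    then show False
      by presburger
  qed
  then show ?thesis
    using eq by simp
qed

text \<open>Modulo the curve equation every polynomial is \<open>a + b y\<close>; primality follows because the norm
  \<open>a\<^sup>2 - x f\<^sup>2 b\<^sup>2\<close> is multiplicative and vanishes only at \<open>0\<close>.\<close>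

lemma primeideal_nodal_ideal:
  fixes f :: "'a::field poly"
  assumes "f \<noteq> 0"
  shows "primeideal (nodal_ideal f) ring_of_type_algebra"
proof (rule primeidealI)
  show "carrier ring_of_type_algebra \<noteq> nodal_ideal f"
    using nodal_dvd_linear[of f 1 0] by (auto simp: ring_of_type_algebra_def nodal_ideal_eq)
next
  fix p q :: "'a poly poly"
  assume "p \<otimes>\<^bsub>ring_of_type_algebra\<^esub> q \<in> nodal_ideal f"
  then have pq: "nodal_poly f dvd p * q"
    by (simp add: nodal_ideal_eq ring_of_type_algebra_def)
  obtain a b where ab: "nodal_poly f dvd p - [:a, b:]"
    using nodal_reduce by blast
  obtain c d where cd: "nodal_poly f dvd q - [:c, d:]"
    using nodal_reduce by blast
  let ?t = "[:0, 1:] * f\<^sup>2"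
  \<comment> \<open>Passing to the linear remainders of both factors and cancelling the
    \<open>y\<^sup>2\<close> term, whose coefficient is \<open>b * d\<close>, leaves a linear
    element of the ideal, so both its coefficients vanish.\<close>
  have "nodal_poly f dvd p * q - (p - [:a, b:]) * q - [:a, b:] * (q - [:c, d:]) - [:b * d:] * nodal_poly f"
    using pq ab cd by (intro dvd_diff) (auto simp del: mult_pCons_left mult_pCons_right)
  also have "p * q - (p - [:a, b:]) * q - [:a, b:] * (q - [:c, d:]) - [:b * d:] * nodal_poly f =
      [:a, b:] * [:c, d:] - [:b * d:] * nodal_poly f"
    by (simp add: algebra_simps del: mult_pCons_left mult_pCons_right)
  also have "\<dots> = [:a * c + ?t * (b * d), a * d + b * c:]"
    by (simp add: power2_eq_square algebra_simps)
  finally have *: "a * c + ?t * (b * d) = 0" "a * d + b * c = 0"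
    using nodal_dvd_linear by blast+
  \<comment> \<open>Brahmagupta's identity, with \<open>t\<close> standing for
    \<open>x f\<^sup>2\<close>.\<close>
  have "(a\<^sup>2 - t * b\<^sup>2) * (c\<^sup>2 - t * d\<^sup>2) = (a * c + t * (b * d))\<^sup>2 - t * (a * d + b * c)\<^sup>2" for t
    by (simp add: power2_eq_square algebra_simps)
  from this[of ?t] have "a\<^sup>2 = ?t * b\<^sup>2 \<or> c\<^sup>2 = ?t * d\<^sup>2"
    using * by simp
  then show "p \<in> nodal_ideal f \<or> q \<in> nodal_ideal f"
    using nodal_norm_eq_0[OF assms, of a b] nodal_norm_eq_0[OF assms, of c d] ab cd
    by (auto simp: nodal_ideal_eq)
qed (auto simp: ideal_nodal_ideal)

lemma domain_coord_ring: "f \<noteq> 0 \<Longrightarrow> domain (coord_ring f)"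
  unfolding coord_ring_def by (intro primeideal.quotient_is_domain primeideal_nodal_ideal)

section \<open>The quotient map onto the coordinate ring\<close>

lemma coord_of_hom: "ring_hom_cring ring_of_type_algebra (coord_ring f) (coord_of f)"
  using ideal.rcos_ring_hom_cring[OF ideal_nodal_ideal cring_from_type_algebra]
  by (simp add: coord_ring_def coord_of_def[abs_def])

lemma coord_of_closed: "coord_of f p \<in> carrier (coord_ring f)"
  and coord_of_add: "coord_of f (p + q) = coord_of f p \<oplus>\<^bsub>coord_ring f\<^esub> coord_of f q"
  and coord_of_mult: "coord_of f (p * q) = coord_of f p \<otimes>\<^bsub>coord_ring f\<^esub> coord_of f q"
proof -
  interpret ring_hom_cring "ring_of_type_algebra" "coord_ring f" "coord_of f"
    by (rule coord_of_hom)
  show "coord_of f p \<in> carrier (coord_ring f)"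
    using hom_closed[of p] by (simp add: ring_of_type_algebra_def)
  show "coord_of f (p + q) = coord_of f p \<oplus>\<^bsub>coord_ring f\<^esub> coord_of f q"
    using hom_add[of p q] by (simp add: ring_of_type_algebra_def)
  show "coord_of f (p * q) = coord_of f p \<otimes>\<^bsub>coord_ring f\<^esub> coord_of f q"
    using hom_mult[of p q] by (simp add: ring_of_type_algebra_def)
qed

lemma coord_of_eq_0_iff: "coord_of f p = \<zero>\<^bsub>coord_ring f\<^esub> \<longleftrightarrow> nodal_poly f dvd p"
proof -
  interpret I: ideal "nodal_ideal f" ring_of_type_algebra
    by (rule ideal_nodal_ideal)
  have "coord_of f p = nodal_ideal f \<longleftrightarrow> p \<in> nodal_ideal f"
    unfolding coord_of_def
    by (metis I.a_coset_join1 I.a_rcos_const UNIV_I I.a_subgroup I.additive_subgroup_axioms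
       partial_object.select_convs(1) ring_of_type_algebra_def)
  then show ?thesis
    by (simp add: coord_ring_def FactRing_def nodal_ideal_eq)
qed

text \<open>The certificate format for the memberships below: \<open>a\<close> and \<open>b\<close>
  are the multipliers of two known members, \<open>c\<close> that of the curve equation. What
  remains is a polynomial identity in \<open>k[x][y]\<close>.\<close>

lemma coord_of_ideal_comb:
  assumes "ideal L (coord_ring f)" "coord_of f p \<in> L" "coord_of f q \<in> L"
    and r: "r = a * p + b * q + c * nodal_poly f"
  shows "coord_of f r \<in> L"
proof -
  interpret L: ideal L "coord_ring f" by fact
  have "coord_of f (c * nodal_poly f) = \<zero>\<^bsub>coord_ring f\<^esub>"
    unfolding coord_of_eq_0_iff by simp
  then have cL: "coord_of f (c * nodal_poly f) \<in> L"
    by simp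
  show ?thesis
    unfolding r coord_of_add coord_of_mult[of f a] coord_of_mult[of f b]
    by (intro additive_subgroup.a_closed[OF L.additive_subgroup_axioms] L.I_l_closed coord_of_closed assms(2,3) cL)
qed

section \<open>Products of the ideals \<open>(f\<^sup>2, y - h f)\<close>\<close>

text \<open>The ideal \<open>I\<^sub>h\<close> of the overview.\<close>

definition nodal_mumford_ideal :: "'a::field poly \<Rightarrow> 'a poly \<Rightarrow> 'a poly poly set set" where
  "nodal_mumford_ideal f h =
     genideal (coord_ring f) {coord_of f [:f\<^sup>2:], coord_of f ([:0, 1:] - [:h * f:])}"

lemma ideal_nodal_mumford_ideal:
  assumes "f \<noteq> 0"
  shows "ideal (nodal_mumford_ideal f h) (coord_ring f)"
proof -
  interpret domain "coord_ring f"
    by (rule domain_coord_ring[OF assms])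
  show ?thesis
    unfolding nodal_mumford_ideal_def by (intro genideal_ideal) (simp add: coord_of_closed)
qed

text \<open>Below \<open>W\<close> is the coordinate \<open>x\<close>, because HOL-Algebra reserves \<open>X\<close> as notation; it also
  shadows the Groebner basis method \<open>algebra\<close>.\<close>

lemma nodal_mumford_ideal_inverse:
  fixes f h :: "'a::field poly"
  assumes f: "f \<noteq> 0" and rs: "r * f + s * ([:0, 1:] - h\<^sup>2) = 1"
  shows "ideal_prod (coord_ring f) (nodal_mumford_ideal f h) (nodal_mumford_ideal f (- h))
    = cgenideal (coord_ring f) (coord_of f [:f\<^sup>2:])"
proof -
  interpret A: domain "coord_ring f"
    by (rule domain_coord_ring[OF f])
  define y :: "'a poly poly" where "y = [:0, 1:]"
  define W :: "'a poly poly" where "W = [:[:0, 1:]:]"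
  \<comment> \<open>Capital letters are the lifts of polynomials in \<open>x\<close> to
    \<open>k[x][y]\<close>, so that all identities live in one ring with atomic symbols.\<close>
  define F H R S where "F = [:f:]" and "H = [:h:]" and "R = [:r:]" and "S = [:s:]"
  note defs = y_def W_def F_def H_def R_def S_def
  have gens: "[:f\<^sup>2:] = F\<^sup>2" "[:0, 1:] - [:h * f:] = y - H * F" "[:0, 1:] - [:- h * f:] = y + H * F"
    and m: "nodal_poly f = y\<^sup>2 - W * F\<^sup>2" and RS: "R * F + S * (W - H\<^sup>2) = 1"
    using rs by (simp_all add: defs power2_eq_square mult.commute)
  define P where "P = ideal_prod (coord_ring f) (nodal_mumford_ideal f h) (nodal_mumford_ideal f (- h))"
  define Q where "Q = cgenideal (coord_ring f) (coord_of f (F\<^sup>2))"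
  have P: "ideal P (coord_ring f)" and Q: "ideal Q (coord_ring f)"
    unfolding P_def Q_def
    by (intro A.ideal_prod_is_ideal ideal_nodal_mumford_ideal f A.cgenideal_ideal coord_of_closed)+
  note combP = coord_of_ideal_comb[OF P, unfolded m]
  note combQ = coord_of_ideal_comb[OF Q, unfolded m]
  have q: "coord_of f (F\<^sup>2) \<in> Q"
    unfolding Q_def by (intro A.cgenideal_self coord_of_closed)
  have "P \<subseteq> Q"
    unfolding P_def nodal_mumford_ideal_def gens
  proof (intro A.ideal_prod_genideal_subset Q)
    fix s t assume "s \<in> {coord_of f (F\<^sup>2), coord_of f (y - H * F)}" "t \<in> {coord_of f (F\<^sup>2), coord_of f (y + H * F)}"
    moreover have "coord_of f (F\<^sup>2 * F\<^sup>2) \<in> Q"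
      by (rule combQ[OF q q, of _ "F\<^sup>2" 0 0]) Groebner_Basis.algebra
    moreover have "coord_of f (F\<^sup>2 * (y + H * F)) \<in> Q"
      by (rule combQ[OF q q, of _ "y + H * F" 0 0]) Groebner_Basis.algebra
    moreover have "coord_of f ((y - H * F) * F\<^sup>2) \<in> Q"
      by (rule combQ[OF q q, of _ "y - H * F" 0 0]) Groebner_Basis.algebra
    \<comment> \<open>The product of the conjugate generators is
      \<open>(W - H\<^sup>2) * F\<^sup>2\<close> modulo the curve equation.\<close>
    moreover have "coord_of f ((y - H * F) * (y + H * F)) \<in> Q"
      by (rule combQ[OF q q, of _ "W - H\<^sup>2" 0 1]) Groebner_Basis.algebra
    ultimately show "s \<otimes>\<^bsub>coord_ring f\<^esub> t \<in> Q"
      unfolding coord_of_mult by auto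
  qed (auto simp: coord_of_closed)
  moreover have "Q \<subseteq> P"
    unfolding Q_def
  proof (rule A.cgenideal_minimal[OF P])
    have gen: "coord_of f (F\<^sup>2) \<in> nodal_mumford_ideal f h" "coord_of f (y - H * F) \<in> nodal_mumford_ideal f h"
      "coord_of f (F\<^sup>2) \<in> nodal_mumford_ideal f (- h)" "coord_of f (y + H * F) \<in> nodal_mumford_ideal f (- h)"
      unfolding nodal_mumford_ideal_def gens
      using A.genideal_self[of "{coord_of f (F\<^sup>2), coord_of f (y - H * F)}"]
        A.genideal_self[of "{coord_of f (F\<^sup>2), coord_of f (y + H * F)}"]
      by (auto simp: coord_of_closed)
    have g1: "coord_of f (F\<^sup>2 * F\<^sup>2) \<in> P" and g2: "coord_of f ((y - H * F) * (y + H * F)) \<in> P"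
      unfolding P_def coord_of_mult using gen by (auto intro: ideal_prod.prod)
    \<comment> \<open>\<open>P\<close> contains \<open>F ^ 4\<close> and, modulo the curve equation,
      \<open>(W - H\<^sup>2) * F\<^sup>2\<close>. Each use of \<open>RS\<close> lowers the power of
      \<open>F\<close> by one, first to the cube and then to the square.\<close>
    have g3: "coord_of f (F ^ 3) \<in> P"
      by (rule combP[OF g1 g2, of _ R "S * F" "- S * F"]) (use RS in Groebner_Basis.algebra)
    show "coord_of f (F\<^sup>2) \<in> P"
      by (rule combP[OF g3 g2, of _ R S "- S"]) (use RS in Groebner_Basis.algebra)
  qed
  ultimately show ?thesis
    unfolding P_def Q_def gens by blast
qed

text \<open>Modulo the curve equation and \<open>f ^ 3\<close>, the product of the two linear
  generators is \<open>- (h1 + h2) * f * (y - h3 * f)\<close>, which gives one inclusion. For the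
  other, \<open>f ^ 3\<close> is recovered first, using that \<open>[:0, 1:] - h1\<^sup>2\<close>,
  \<open>[:0, 1:] - h2\<^sup>2\<close> and \<open>h1 + h2\<close> are units modulo
  \<open>f\<close>.\<close>

lemma nodal_mumford_ideal_mult:
  fixes f h1 h2 h3 :: "'a::field poly"
  assumes f: "f \<noteq> 0"
    and 1: "a1 * f + b1 * ([:0, 1:] - h1\<^sup>2) = 1" and 2: "a2 * f + b2 * ([:0, 1:] - h2\<^sup>2) = 1"
    and g: "g1 * f + g2 * (h1 + h2) = 1"
    and h3: "h3 = g2 * (h1 * h2 + [:0, 1:]) + k * f"
  shows "ideal_prod (coord_ring f) (nodal_mumford_ideal f h1) (nodal_mumford_ideal f h2)
    = ideal_prod (coord_ring f) (cgenideal (coord_ring f) (coord_of f [:f:])) (nodal_mumford_ideal f h3)"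
proof -
  interpret A: domain "coord_ring f"
    by (rule domain_coord_ring[OF f])
  define y :: "'a poly poly" where "y = [:0, 1:]"
  define W :: "'a poly poly" where "W = [:[:0, 1:]:]"
  define F H1 H2 H3 where "F = [:f:]" and "H1 = [:h1:]" and "H2 = [:h2:]" and "H3 = [:h3:]"
  define A1 B1 A2 B2 G1 G2 K where "A1 = [:a1:]" and "B1 = [:b1:]" and "A2 = [:a2:]" and "B2 = [:b2:]"
    and "G1 = [:g1:]" and "G2 = [:g2:]" and "K = [:k:]"
  note defs = y_def W_def F_def H1_def H2_def H3_def A1_def B1_def A2_def B2_def G1_def G2_def K_def
  have gens: "[:f\<^sup>2:] = F\<^sup>2" "[:0, 1:] - [:h1 * f:] = y - H1 * F" "[:0, 1:] - [:h2 * f:] = y - H2 * F"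
     "[:0, 1:] - [:h3 * f:] = y - H3 * F" "[:f:] = F"
    and m: "nodal_poly f = y\<^sup>2 - W * F\<^sup>2"
    by (simp_all add: defs power2_eq_square mult.commute)
  have E1: "A1 * F + B1 * (W - H1\<^sup>2) = 1" and E2: "A2 * F + B2 * (W - H2\<^sup>2) = 1"
    and G: "G1 * F + G2 * (H1 + H2) = 1" and H3: "H3 = G2 * (H1 * H2 + W) + K * F"
    using 1 2 g h3 by (simp_all add: defs power2_eq_square mult.commute)
  define P where "P = ideal_prod (coord_ring f) (nodal_mumford_ideal f h1) (nodal_mumford_ideal f h2)"
  define Q where "Q = ideal_prod (coord_ring f) (cgenideal (coord_ring f) (coord_of f [:f:])) (nodal_mumford_ideal f h3)"
  have P: "ideal P (coord_ring f)" and Q: "ideal Q (coord_ring f)"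
    unfolding P_def Q_def
    by (intro A.ideal_prod_is_ideal ideal_nodal_mumford_ideal f A.cgenideal_ideal coord_of_closed)+
  note combP = coord_of_ideal_comb[OF P, unfolded m]
  note combQ = coord_of_ideal_comb[OF Q, unfolded m]
  have gen: "coord_of f (F\<^sup>2) \<in> nodal_mumford_ideal f h" "coord_of f (y - [:h * f:]) \<in> nodal_mumford_ideal f h" for h
    unfolding nodal_mumford_ideal_def gens y_def
    using A.genideal_self[of "{coord_of f (F\<^sup>2), coord_of f ([:0, 1:] - [:h * f:])}"]
    by (auto simp: coord_of_closed)
  have gen': "coord_of f (y - H1 * F) \<in> nodal_mumford_ideal f h1"
    "coord_of f (y - H2 * F) \<in> nodal_mumford_ideal f h2"
    "coord_of f (y - H3 * F) \<in> nodal_mumford_ideal f h3"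
    using gen(2)[of h1] gen(2)[of h2] gen(2)[of h3] by (simp_all add: defs mult.commute)
  have "P \<subseteq> Q"
    unfolding P_def nodal_mumford_ideal_def gens
  proof (intro A.ideal_prod_genideal_subset Q)
    have "coord_of f F \<in> cgenideal (coord_ring f) (coord_of f [:f:])"
      unfolding gens by (intro A.cgenideal_self coord_of_closed)
    then have q: "coord_of f (F * F\<^sup>2) \<in> Q" "coord_of f (F * (y - H3 * F)) \<in> Q"
      unfolding Q_def coord_of_mult using gen gen' by (auto intro: ideal_prod.prod)
    fix s t assume "s \<in> {coord_of f (F\<^sup>2), coord_of f (y - H1 * F)}" "t \<in> {coord_of f (F\<^sup>2), coord_of f (y - H2 * F)}"
    moreover have "coord_of f (F\<^sup>2 * F\<^sup>2) \<in> Q"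
      by (rule combQ[OF q, of _ F 0 0]) Groebner_Basis.algebra
    moreover have "coord_of f (F\<^sup>2 * (y - H2 * F)) \<in> Q"
      by (rule combQ[OF q, of _ "H3 - H2" F 0]) Groebner_Basis.algebra
    moreover have "coord_of f ((y - H1 * F) * F\<^sup>2) \<in> Q"
      by (rule combQ[OF q, of _ "H3 - H1" F 0]) Groebner_Basis.algebra
    \<comment> \<open>As in \<open>bezout_sum\<close>, \<open>G2\<close> inverts
      \<open>H1 + H2\<close> modulo \<open>F\<close>; the cofactor is the negative of the
      \<open>w\<close> used there.\<close>
    moreover have key: "W + H1 * H2 - (H1 + H2) * H3 = F * ((W + H1 * H2) * G1 - (H1 + H2) * K)"
      using G unfolding H3 by Groebner_Basis.algebra
    have "coord_of f ((y - H1 * F) * (y - H2 * F)) \<in> Q"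
      by (rule combQ[OF q, of _ "(W + H1 * H2) * G1 - (H1 + H2) * K" "- (H1 + H2)" 1])
        (use key in Groebner_Basis.algebra)
    ultimately show "s \<otimes>\<^bsub>coord_ring f\<^esub> t \<in> Q"
      unfolding coord_of_mult by auto
  qed (auto simp: coord_of_closed)
  moreover have "Q \<subseteq> P"
    unfolding Q_def nodal_mumford_ideal_def gens A.cgenideal_eq_genideal[OF coord_of_closed]
  proof (intro A.ideal_prod_genideal_subset P)
    have p1: "coord_of f (F\<^sup>2 * F\<^sup>2) \<in> P" and p2: "coord_of f (F\<^sup>2 * (y - H2 * F)) \<in> P"
      and p3: "coord_of f ((y - H1 * F) * F\<^sup>2) \<in> P"
      and p4: "coord_of f ((y - H1 * F) * (y - H2 * F)) \<in> P"
      unfolding P_def coord_of_mult using gen gen' by (auto intro: ideal_prod.prod)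
    \<comment> \<open>Modulo the curve equation \<open>p4\<close> concerns
      \<open>(W + H1 * H2) * F\<^sup>2 - (H1 + H2) * F * y\<close>. Multiplying by \<open>y\<close>
      and subtracting \<open>W + H1 * H2\<close> times the element of \<open>p3\<close> cancels the
      terms in \<open>y\<close> and leaves a multiple of \<open>F ^ 3\<close>.\<close>
    have "coord_of f (F ^ 3 * H2 * (H1\<^sup>2 - W)) \<in> P"
      by (rule combP[OF p4 p3, of _ y "- (W + H1 * H2)" "- (y - (H1 + H2) * F)"]) Groebner_Basis.algebra
    \<comment> \<open>By \<open>E1\<close> the factor \<open>H1\<^sup>2 - W\<close> is a unit modulo
      \<open>F\<close>; it can be removed because \<open>F ^ 4\<close> lies in
      \<open>P\<close>.\<close>
    then have p5: "coord_of f (F ^ 3 * H2) \<in> P"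
      by (rule combP[OF p1, of _ _ "A1 * H2" "- B1" 0]) (use E1 in Groebner_Basis.algebra)
    have "coord_of f (F ^ 3 * H1 * (H2\<^sup>2 - W)) \<in> P"
      by (rule combP[OF p4 p2, of _ y "- (W + H1 * H2)" "- (y - (H1 + H2) * F)"]) Groebner_Basis.algebra
    then have p6: "coord_of f (F ^ 3 * H1) \<in> P"
      by (rule combP[OF p1, of _ _ "A2 * H1" "- B2" 0]) (use E2 in Groebner_Basis.algebra)
    have "coord_of f (F ^ 3 * (H1 + H2)) \<in> P"
      by (rule combP[OF p5 p6, of _ 1 1 0]) Groebner_Basis.algebra
    \<comment> \<open>The factor \<open>H1 + H2\<close> is removed in the same way, by
      \<open>G\<close>.\<close>
    then have p7: "coord_of f (F * F\<^sup>2) \<in> P"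
      by (rule combP[OF p1, of _ _ G1 G2 0]) (use G in Groebner_Basis.algebra)
    have "coord_of f (F\<^sup>2 * y) \<in> P"
      by (rule combP[OF p3 p7, of _ 1 H1 0]) Groebner_Basis.algebra
    \<comment> \<open>The target of \<open>p8\<close> is a combination of three members of
      \<open>P\<close>, while \<open>coord_of_ideal_comb\<close> takes two at a time, so two of them
      are merged first.\<close>
    then have "coord_of f (G1 * (F\<^sup>2 * y) - K * (F * F\<^sup>2)) \<in> P"
      by (rule combP[OF _ p7, of _ _ G1 "- K" 0]) Groebner_Basis.algebra
    \<comment> \<open>Writing \<open>F * y\<close> as
      \<open>(G1 * F + G2 * (H1 + H2)) * F * y\<close> and expanding \<open>H3\<close> produces the
      merged element minus \<open>G2\<close> times that of \<open>p4\<close>, up to the curve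
      equation.\<close>
    then have p8: "coord_of f (F * (y - H3 * F)) \<in> P"
      by (rule combP[OF _ p4, of _ _ 1 "- G2" G2]) (use G H3 in Groebner_Basis.algebra)
    fix s t assume "s \<in> {coord_of f F}" "t \<in> {coord_of f (F\<^sup>2), coord_of f (y - H3 * F)}"
    then show "s \<otimes>\<^bsub>coord_ring f\<^esub> t \<in> P"
      using p7 p8 by (auto simp: coord_of_mult)
  qed (auto simp: coord_of_closed)
  ultimately show ?thesis
    unfolding P_def Q_def gens by blast
qed

section \<open>Classes in the Jacobian and the addition law\<close>

lemma mumford_class_nodal: "mumford_class f (f\<^sup>2) (h * f) = ideal_class (coord_ring f) (nodal_mumford_ideal f h)"
  by (simp add: mumford_class_def nodal_mumford_ideal_def)

lemma coord_of_const_nonzero: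
  assumes "p \<noteq> 0"
  shows "coord_of f [:p:] \<noteq> \<zero>\<^bsub>coord_ring f\<^esub>"
  using nodal_dvd_linear[of f p 0] assms by (auto simp: coord_of_eq_0_iff)

text \<open>The product with the ideal for \<open>- h\<close> is generated by the nonzero element
  \<open>f\<^sup>2\<close>, so the criterion \<open>embed_invertible\<close> applies.\<close>

lemma nodal_mumford_ideal_invertible:
  fixes f h :: "'a::field poly"
  assumes "f \<noteq> 0" "r * f + s * ([:0, 1:] - h\<^sup>2) = 1"
  shows "frac_embed (coord_ring f) ` nodal_mumford_ideal f h \<in> carrier (invertible_frac_ideals (coord_ring f))"
    and "mumford_class f (f\<^sup>2) (h * f) \<in> carrier (Jac f)"
proof -
  interpret A: domain "coord_ring f"
    by (rule domain_coord_ring[OF assms(1)])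
  have *: "coord_of f [:f\<^sup>2:] \<noteq> \<zero>\<^bsub>coord_ring f\<^esub>"
    using assms(1) by (intro coord_of_const_nonzero) simp
  note I = ideal_nodal_mumford_ideal[OF assms(1)]
  show "frac_embed (coord_ring f) ` nodal_mumford_ideal f h \<in> carrier (invertible_frac_ideals (coord_ring f))"
    by (rule A.embed_invertible[OF I I nodal_mumford_ideal_inverse[OF assms] coord_of_closed *])
  show "mumford_class f (f\<^sup>2) (h * f) \<in> carrier (Jac f)"
    unfolding mumford_class_nodal Jac_def
    by (rule A.ideal_class_closed[OF I I nodal_mumford_ideal_inverse[OF assms] coord_of_closed *])
qed

text \<open>Quantifying over all \<open>g1\<close>, \<open>g2\<close> expresses that any outcome of
  step (1) may be used. If \<open>h1 + h2 = 0\<close>, step (1) would make \<open>f\<close> a unit;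
  the two classes are then inverse to each other, as \<open>nodal_mumford_ideal_inverse\<close>
  shows that the product ideal is principal.\<close>

theorem lemma1p4:
  fixes f h1 h2 :: "'a::{field, finite} poly" and d :: nat
  assumes "CHAR('a) \<noteq> 2"
    and "irreducible f" and "degree f = d"
    and "coprime f ([:0, 1:] - h1\<^sup>2)" and "h1 = 0 \<or> degree h1 < d"
    and "coprime f ([:0, 1:] - h2\<^sup>2)" and "h2 = 0 \<or> degree h2 < d"
  shows "mumford_rep f (f\<^sup>2) (h1 * f) \<and> mumford_class f (f\<^sup>2) (h1 * f) \<in> carrier (Jac f) \<and>
    mumford_rep f (f\<^sup>2) (h2 * f) \<and> mumford_class f (f\<^sup>2) (h2 * f) \<in> carrier (Jac f) \<and>
    (h1 + h2 \<noteq> 0 \<longrightarrow> (\<exists>g1 g2. g1 * f + g2 * (h1 + h2) = 1)) \<and>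
    (\<forall>g1 g2. g1 * f + g2 * (h1 + h2) = 1 \<longrightarrow>
      (\<exists>!h3. (h3 = 0 \<or> degree h3 < d) \<and>
         [h3 = f * h1 * g1 + g2 * (h1 * h2 + [:0, 1:])] (mod f)) \<and>
      (\<forall>h3. (h3 = 0 \<or> degree h3 < d) \<and>
         [h3 = f * h1 * g1 + g2 * (h1 * h2 + [:0, 1:])] (mod f) \<longrightarrow>
         mumford_rep f (f\<^sup>2) (h3 * f) \<and> mumford_class f (f\<^sup>2) (h3 * f) \<in> carrier (Jac f) \<and>
         mumford_class f (f\<^sup>2) (h1 * f) \<otimes>\<^bsub>Jac f\<^esub> mumford_class f (f\<^sup>2) (h2 * f)
           = mumford_class f (f\<^sup>2) (h3 * f)))"
proof -
  have f0: "f \<noteq> 0"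
    using assms(2) by auto
  have d: "degree f > 0"
    using assms(2) f0 is_unit_iff_degree[of f] by (auto dest: irreducible_not_unit)
  obtain a1 b1 where 1: "a1 * f + b1 * ([:0, 1:] - h1\<^sup>2) = 1"
    using coprime_bezout[OF assms(4)] .
  obtain a2 b2 where 2: "a2 * f + b2 * ([:0, 1:] - h2\<^sup>2) = 1"
    using coprime_bezout[OF assms(6)] .
  have g: "\<exists>g1 g2. g1 * f + g2 * (h1 + h2) = 1" if "h1 + h2 \<noteq> 0"
  proof -
    have "degree (h1 + h2) < degree f"
      using assms(3,5,7) d degree_add_less[of h1 "degree f" h2] by auto
    from irreducible_bezout_degree[OF assms(2) that this] show ?thesis
      by metis
  qed
  have mod_eq: "h mod f = h" if "h = 0 \<or> degree h < d" for h
    using that assms(3) mod_poly_less by auto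
  have ex1: "\<exists>!h3. (h3 = 0 \<or> degree h3 < d) \<and> [h3 = e] (mod f)" for e
  proof (rule ex1I[of _ "e mod f"])
    show "(e mod f = 0 \<or> degree (e mod f) < d) \<and> [e mod f = e] (mod f)"
      using degree_mod_less[OF f0] assms(3) by (auto simp: cong_def)
  qed (auto simp: cong_def mod_eq)
  have sum: "mumford_rep f (f\<^sup>2) (h3 * f)" "mumford_class f (f\<^sup>2) (h3 * f) \<in> carrier (Jac f)"
    "mumford_class f (f\<^sup>2) (h1 * f) \<otimes>\<^bsub>Jac f\<^esub> mumford_class f (f\<^sup>2) (h2 * f) = mumford_class f (f\<^sup>2) (h3 * f)"
    if G: "g1 * f + g2 * (h1 + h2) = 1" and deg: "h3 = 0 \<or> degree h3 < d"
      and cong: "[h3 = f * h1 * g1 + g2 * (h1 * h2 + [:0, 1:])] (mod f)" for g1 g2 h3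
  proof -
    interpret A: domain "coord_ring f"
      by (rule domain_coord_ring[OF f0])
    have "f dvd h3 - (f * h1 * g1 + g2 * (h1 * h2 + [:0, 1:]))"
      using cong unfolding cong_def by (rule mod_eq_dvd_iff[THEN iffD1])
    then obtain k where "h3 - (f * h1 * g1 + g2 * (h1 * h2 + [:0, 1:])) = f * k"
      by blast
    \<comment> \<open>The summand \<open>f * h1 * g1\<close> is a multiple of \<open>f\<close> and
      is absorbed into the cofactor, which gives the form expected by \<open>bezout_sum\<close> and
      \<open>nodal_mumford_ideal_mult\<close>.\<close>
    then have h3: "h3 = g2 * (h1 * h2 + [:0, 1:]) + (k + h1 * g1) * f"
      by (simp add: algebra_simps)
    \<comment> \<open>This identity yields both the Mumford conditions for \<open>h3\<close> and the
      invertibility of its ideal.\<close>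
    obtain a3 b3 where 3: "a3 * f + b3 * ([:0, 1:] - h3\<^sup>2) = 1"
      using bezout_sum[OF 1 2 G h3] by blast
    note I = ideal_nodal_mumford_ideal[OF f0]
    show "mumford_rep f (f\<^sup>2) (h3 * f)"
      using mumford_rep_nodal[OF d _ 3] deg assms(3) by simp
    show "mumford_class f (f\<^sup>2) (h3 * f) \<in> carrier (Jac f)"
      by (rule nodal_mumford_ideal_invertible(2)[OF f0 3])
    show "mumford_class f (f\<^sup>2) (h1 * f) \<otimes>\<^bsub>Jac f\<^esub> mumford_class f (f\<^sup>2) (h2 * f) =
        mumford_class f (f\<^sup>2) (h3 * f)"
      unfolding mumford_class_nodal Jac_def
      by (rule A.ideal_class_mult[OF I I I coord_of_closed coord_of_const_nonzero[OF f0]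
            nodal_mumford_ideal_mult[OF f0 1 2 G h3] nodal_mumford_ideal_invertible(1)[OF f0 1]
            nodal_mumford_ideal_invertible(1)[OF f0 2] nodal_mumford_ideal_invertible(1)[OF f0 3]])
  qed
  have rep: "mumford_rep f (f\<^sup>2) (h1 * f)" "mumford_rep f (f\<^sup>2) (h2 * f)"
    using mumford_rep_nodal[OF d _ 1] mumford_rep_nodal[OF d _ 2] assms(3,5,7) by simp_all
  note cl = nodal_mumford_ideal_invertible(2)[OF f0 1] nodal_mumford_ideal_invertible(2)[OF f0 2]
  show ?thesis
    by (intro conjI allI impI rep cl g ex1; (assumption | (elim conjE, rule sum; assumption)))
qed

end
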